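(* Let $\Omega\subset\mathbb{R}^n$ be a bounded domain with $C^2$ boundary, let $p:\Omega\to(1,\infty)$ be continuous with $p_-:=\inf_{x\in\Omega}p(x)>n$ (the case $\sup_\Omega p=\infty$ is included), and let $\varphi\in W^{1,p}(\Omega)$ be such that $\int_\Omega\frac{|\nabla\varphi|^p}{p}\,dx<\infty$. Then there exists at most one weak solution $v\in W^{1,p}(\Omega)$ to the Dirichlet problem $$\operatorname{div}\left(|\nabla v|^{p-2}\nabla v\right)=0\ \text{ in }\Omega,\qquad v-\varphi\in V^{1,p}_0(\Omega),$$ satisfying $\int_\Omega p^{-1}|\nabla v|^p\,dx<\infty$ and such that the inequality $$\int_\Omega |\nabla v|^{p-2}\,\nabla v\cdot\nabla(w+v-\varphi)\,dx\le 0$$ holds for every $w\in V^{1,p}_0(\Omega)$ such that $\int_\Omega p^{-1}|\nabla(w-\varphi)|^p\,dx<\infty$.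
   Context: For a measurable function $u$ on $\Omega$, $\rho_p(u)=\int_\Omega \frac{|u(x)|^{p(x)}}{p(x)}\,dx$. For a function $u$ whose first-order distributional derivatives are functions, $\rho_{1,p}(u)=\rho_p(u)+\rho_p(|\nabla u|)$, where $|\nabla u|$ is the Euclidean norm of the gradient. $W^{1,p}(\Omega)$ is the space of real-valued Borel measurable functions $u$ on $\Omega$ with such derivatives for which $\rho_{1,p}(\lambda u)<\infty$ for some $\lambda>0$ (functions are identified if they agree a.e.). A set $A\subset W^{1,p}(\Omega)$ is $\rho_{1,p}$-closed if whenever $(u_j)\subset A$, $u\in W^{1,p}(\Omega)$ and $\rho_{1,p}(u_j-u)\to0$, then $u\in A$. $V^{1,p}_0(\Omega)$ is the $\rho_{1,p}$-closure of $C_0^\infty(\Omega)$ in $W^{1,p}(\Omega)$, i.e. the intersection of all $\rho_{1,p}$-closed subsets of $W^{1,p}(\Omega)$ containing $C_0^\infty(\Omega)$. A weak solution satisfies $\int_\Omega |\nabla v|^{p-2}\nabla v\cdot\nabla h\,dx=0$ for all $h\in C_0^\infty(\Omega)$. *)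

theory Defs
  imports "HOL-Analysis.Analysis"
begin

section \<open>Test functions and domains\<close>

text \<open>Meant for open \<open>S\<close> in a finite-dimensional space, where continuity of all iterated
  directional derivatives up to order \<open>k\<close> is the usual notion of class \<open>C\<^sup>k\<close>.\<close>

primrec Ck_on :: "nat \<Rightarrow> ('a::real_normed_vector \<Rightarrow> 'b::real_normed_vector) \<Rightarrow> 'a set \<Rightarrow> bool"
where
  "Ck_on 0 f S \<longleftrightarrow> continuous_on S f"
| "Ck_on (Suc k) f S \<longleftrightarrow>
     (\<forall>x\<in>S. f differentiable (at x)) \<and> (\<forall>v. Ck_on k (\<lambda>x. frechet_derivative f (at x) v) S)"

text \<open>The elements of \<open>C\<^sub>0\<^sup>\<infinity>(\<Omega>)\<close> are represented by their extensions by zero.\<close>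

definition test_functions :: "(real^'n) set \<Rightarrow> ((real^'n) \<Rightarrow> real) set" where
  "test_functions \<Omega> = {h. (\<forall>k. Ck_on k h UNIV) \<and>
     compact (closure {x. h x \<noteq> 0}) \<and> closure {x. h x \<noteq> 0} \<subseteq> \<Omega>}"

definition grad :: "((real^'n) \<Rightarrow> real) \<Rightarrow> (real^'n) \<Rightarrow> real^'n" where
  "grad h x = (\<chi> i. frechet_derivative h (at x) (axis i 1))"

text \<open>Near each boundary point, \<open>\<Omega>\<close> lies strictly on one side of the graph of a \<open>C\<^sup>2\<close> function over
  the hyperplane orthogonal to a unit vector \<open>\<nu>\<close> (the last axis of a rotated coordinate system).
  The function lives on the whole space but is only evaluated on that hyperplane, which avoids
  a separate type for \<open>(n-1)\<close>-dimensional space.\<close>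

definition C2_boundary :: "(real^'n) set \<Rightarrow> bool" where
  "C2_boundary \<Omega> \<longleftrightarrow> (\<forall>x0\<in>frontier \<Omega>. \<exists>r>0. \<exists>\<nu> (\<gamma> :: (real^'n) \<Rightarrow> real).
     norm \<nu> = 1 \<and> Ck_on 2 \<gamma> UNIV \<and>
     \<Omega> \<inter> ball x0 r = {x \<in> ball x0 r. \<gamma> (x - (x \<bullet> \<nu>) *\<^sub>R \<nu>) < x \<bullet> \<nu>})"

definition bounded_C2_domain :: "(real^'n) set \<Rightarrow> bool" where
  "bounded_C2_domain \<Omega> \<longleftrightarrow>
     open \<Omega> \<and> connected \<Omega> \<and> \<Omega> \<noteq> {} \<and> bounded \<Omega> \<and> C2_boundary \<Omega>"

section \<open>Weak gradients\<close>

definition locally_integrable ::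
  "(real^'n) set \<Rightarrow> ((real^'n) \<Rightarrow> 'b::{banach, second_countable_topology}) \<Rightarrow> bool" where
  "locally_integrable \<Omega> f \<longleftrightarrow> (\<forall>K. compact K \<and> K \<subseteq> \<Omega> \<longrightarrow> set_integrable lborel K f)"

definition is_weak_gradient ::
  "(real^'n) set \<Rightarrow> ((real^'n) \<Rightarrow> real) \<Rightarrow> ((real^'n) \<Rightarrow> real^'n) \<Rightarrow> bool" where
  "is_weak_gradient \<Omega> u g \<longleftrightarrow> locally_integrable \<Omega> u \<and> locally_integrable \<Omega> g \<and>
     (\<forall>h\<in>test_functions \<Omega>.
        (LINT x:\<Omega>|lborel. u x *\<^sub>R grad h x) = - (LINT x:\<Omega>|lborel. h x *\<^sub>R g x))"

definition weakly_differentiable :: "(real^'n) set \<Rightarrow> ((real^'n) \<Rightarrow> real) \<Rightarrow> bool" where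
  "weakly_differentiable \<Omega> u \<longleftrightarrow> (\<exists>g. is_weak_gradient \<Omega> u g)"

text \<open>A weak gradient is unique up to null sets, so the choice of representative is immaterial.\<close>

definition weak_grad :: "(real^'n) set \<Rightarrow> ((real^'n) \<Rightarrow> real) \<Rightarrow> (real^'n) \<Rightarrow> real^'n" where
  "weak_grad \<Omega> u = (SOME g. is_weak_gradient \<Omega> u g)"

section \<open>Variable exponent Sobolev spaces\<close>

text \<open>Functions on \<open>\<Omega>\<close> are represented by functions on the whole space whose values outside \<open>\<Omega>\<close> are
  irrelevant.  They are not quotiented by equality almost everywhere; a set that is closed in the
  sense of \<open>modular_closed\<close> below is automatically invariant under changes on null sets.\<close>

definition rho :: "(real^'n) set \<Rightarrow> ((real^'n) \<Rightarrow> real) \<Rightarrow> ((real^'n) \<Rightarrow> real) \<Rightarrow> ennreal" where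
  "rho \<Omega> p u = (\<integral>\<^sup>+ x\<in>\<Omega>. ennreal (\<bar>u x\<bar> powr p x / p x) \<partial>lborel)"

abbreviation grad_energy ::
  "(real^'n) set \<Rightarrow> ((real^'n) \<Rightarrow> real) \<Rightarrow> ((real^'n) \<Rightarrow> real) \<Rightarrow> ennreal" where
  "grad_energy \<Omega> p u \<equiv> rho \<Omega> p (\<lambda>x. norm (weak_grad \<Omega> u x))"

definition rho1 :: "(real^'n) set \<Rightarrow> ((real^'n) \<Rightarrow> real) \<Rightarrow> ((real^'n) \<Rightarrow> real) \<Rightarrow> ennreal" where
  "rho1 \<Omega> p u = rho \<Omega> p u + grad_energy \<Omega> p u"

definition W1p :: "(real^'n) set \<Rightarrow> ((real^'n) \<Rightarrow> real) \<Rightarrow> ((real^'n) \<Rightarrow> real) set" where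
  "W1p \<Omega> p = {u. set_borel_measurable borel \<Omega> u \<and> weakly_differentiable \<Omega> u \<and>
     (\<exists>c>0. rho1 \<Omega> p (\<lambda>x. c * u x) < \<infinity>)}"

definition modular_closed ::
  "(real^'n) set \<Rightarrow> ((real^'n) \<Rightarrow> real) \<Rightarrow> ((real^'n) \<Rightarrow> real) set \<Rightarrow> bool" where
  "modular_closed \<Omega> p A \<longleftrightarrow> A \<subseteq> W1p \<Omega> p \<and>
     (\<forall>f u. range f \<subseteq> A \<and> u \<in> W1p \<Omega> p \<and>
        (\<lambda>j::nat. rho1 \<Omega> p (\<lambda>x. f j x - u x)) \<longlonglongrightarrow> 0 \<longrightarrow> u \<in> A)"

definition V01p :: "(real^'n) set \<Rightarrow> ((real^'n) \<Rightarrow> real) \<Rightarrow> ((real^'n) \<Rightarrow> real) set" where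
  "V01p \<Omega> p = \<Inter>{A. modular_closed \<Omega> p A \<and> test_functions \<Omega> \<subseteq> A}"

section \<open>The Dirichlet problem\<close>

definition p_flux ::
  "(real^'n) set \<Rightarrow> ((real^'n) \<Rightarrow> real) \<Rightarrow> ((real^'n) \<Rightarrow> real) \<Rightarrow> (real^'n) \<Rightarrow> real^'n" where
  "p_flux \<Omega> p v x = norm (weak_grad \<Omega> v x) powr (p x - 2) *\<^sub>R weak_grad \<Omega> v x"

text \<open>Integrability is stated separately since the Bochner integral of a non-integrable function
  is \<open>0\<close> by convention.\<close>

definition weak_solution ::
  "(real^'n) set \<Rightarrow> ((real^'n) \<Rightarrow> real) \<Rightarrow> ((real^'n) \<Rightarrow> real) \<Rightarrow> bool" where
  "weak_solution \<Omega> p v \<longleftrightarrow> (\<forall>h\<in>test_functions \<Omega>.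
     set_integrable lborel \<Omega> (\<lambda>x. p_flux \<Omega> p v x \<bullet> grad h x) \<and>
     (LINT x:\<Omega>|lborel. p_flux \<Omega> p v x \<bullet> grad h x) = 0)"

text \<open>By Young's inequality the integrand below is at least
  \<open>|\<nabla>v|\<^sup>p/p - |\<nabla>(w-\<phi>)|\<^sup>p/p\<close>, so for \<open>v\<close> and \<open>w - \<phi>\<close> of finite energy its integral is well defined in
  \<open>(-\<infinity>, \<infinity>]\<close>; that it is at most \<open>0\<close> includes integrability.\<close>

definition variational_inequality ::
  "(real^'n) set \<Rightarrow> ((real^'n) \<Rightarrow> real) \<Rightarrow> ((real^'n) \<Rightarrow> real) \<Rightarrow> ((real^'n) \<Rightarrow> real) \<Rightarrow> bool" where
  "variational_inequality \<Omega> p \<phi> v \<longleftrightarrow>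
     (\<forall>w\<in>V01p \<Omega> p. grad_energy \<Omega> p (\<lambda>x. w x - \<phi> x) < \<infinity> \<longrightarrow>
        set_integrable lborel \<Omega> (\<lambda>x. p_flux \<Omega> p v x \<bullet> weak_grad \<Omega> (\<lambda>y. w y + v y - \<phi> y) x) \<and>
        (LINT x:\<Omega>|lborel. p_flux \<Omega> p v x \<bullet> weak_grad \<Omega> (\<lambda>y. w y + v y - \<phi> y) x) \<le> 0)"

definition dirichlet_solution ::
  "(real^'n) set \<Rightarrow> ((real^'n) \<Rightarrow> real) \<Rightarrow> ((real^'n) \<Rightarrow> real) \<Rightarrow> ((real^'n) \<Rightarrow> real) \<Rightarrow> bool" where
  "dirichlet_solution \<Omega> p \<phi> v \<longleftrightarrow>
     v \<in> W1p \<Omega> p \<and> weak_solution \<Omega> p v \<and> (\<lambda>x. v x - \<phi> x) \<in> V01p \<Omega> p"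

end

theory Submission
  imports Defs
begin

text \<open>Write \<open>F v = |\<nabla>v|\<^sup>p\<^sup>-\<^sup>2 \<nabla>v\<close>.  The function \<open>w = \<phi> - v\<^sub>2\<close> is admissible in the
  variational inequality for \<open>v\<^sub>1\<close>, because \<open>V\<^sub>0\<close> is symmetric and \<open>w - \<phi> = -v\<^sub>2\<close> has finite energy;
  the result is \<open>\<integral> F v\<^sub>1 \<bullet> \<nabla>(v\<^sub>1 - v\<^sub>2) \<le> 0\<close>.  Exchanging the roles of the two solutions and adding gives
  \<open>\<integral> (F v\<^sub>1 - F v\<^sub>2) \<bullet> (\<nabla>v\<^sub>1 - \<nabla>v\<^sub>2) \<le> 0\<close>.  The integrand is nonnegative and vanishes only where the two
  gradients agree (\<open>power_flux_strictly_monotone\<close>), so \<open>v = v\<^sub>1 - v\<^sub>2\<close> has gradient zero almost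
  everywhere.

  It remains to use the boundary condition.  For a smooth function \<open>u\<close> with compact support in \<open>\<Omega>\<close>
  the identity \<open>\<integral>\<^sub>\<Omega> u \<nabla>k = - \<integral>\<^sub>\<Omega> k \<nabla>u\<close> holds for every test function \<open>k\<close> on the whole space, not only
  for those supported in \<open>\<Omega>\<close>.  It says that the extension of \<open>u\<close> by zero is weakly differentiable on
  the whole space.  Both sides are continuous with respect to convergence of \<open>u\<close> and \<open>\<nabla>u\<close> in
  \<open>L\<^sup>1(\<Omega>)\<close>, and on a bounded domain modular convergence implies \<open>L\<^sup>1\<close> convergence, whether or not the
  exponent is bounded (\<open>L1_tendsto_0_of_rho_tendsto_0\<close>).  Hence the identity passes to all of \<open>V\<^sub>0\<close>
  (\<open>boundary_functional_V01p\<close>), and by linearity to \<open>v = (v\<^sub>1 - \<phi>) - (v\<^sub>2 - \<phi>)\<close>.  So the extension of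
  \<open>v\<close> by zero has gradient zero on the whole space: its pairing with a translate of a test function
  does not depend on the translation, and it is zero once the support has left \<open>\<Omega>\<close>.  Thus \<open>v\<close> pairs
  to zero with every test function (\<open>zero_of_zero_extension_gradient\<close>) and is zero almost everywhere
  by the fundamental lemma of the calculus of variations (\<open>fundamental_lemma\<close>).  The same lemma gives
  the uniqueness of weak gradients, on which all computations with the chosen representative
  \<open>weak_grad\<close> rest.\<close>

section \<open>Smooth approximations of the indicator of a box\<close>


text \<open>The case \<open>k = 0\<close> is the classical smooth function that is flat at the origin.  The powers of
  \<open>1 / t\<close> are there so that the family is closed under differentiation up to linear combinations.\<close>

definition flat :: "nat \<Rightarrow> real \<Rightarrow> real" where
  "flat k t = (if 0 < t then (1 / t) ^ k * exp (- (1 / t)) else 0)"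

lemma power_le_fact_exp:
  fixes s :: real
  assumes "0 \<le> s"
  shows "s ^ n \<le> fact n * exp s"
proof -
  have "s ^ n /\<^sub>R fact n \<le> exp s"
    using sums_unique[OF exp_converges[of s]] summable_exp_generic[of s] assms
      sum_le_suminf[of "\<lambda>n. s ^ n /\<^sub>R fact n" "{n}"] by simp
  then show ?thesis
    by (simp add: field_simps)
qed

lemma flat_bounds: "0 \<le> flat k t" "flat k t \<le> fact (k + 2) * t\<^sup>2"
proof -
  show "0 \<le> flat k t" by (simp add: flat_def)
  show "flat k t \<le> fact (k + 2) * t\<^sup>2"
  proof (cases "0 < t")
    case True
    have "(1 / t) ^ (k + 2) \<le> fact (k + 2) * exp (1 / t)"
      by (rule power_le_fact_exp) (use True in simp)
    then have "(1 / t) ^ (k + 2) * (t\<^sup>2 * exp (- (1 / t))) \<le> fact (k + 2) * exp (1 / t) * (t\<^sup>2 * exp (- (1 / t)))"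
      by (intro mult_right_mono) auto
    moreover have "(1 / t) ^ (k + 2) * (t\<^sup>2 * exp (- (1 / t))) = flat k t"
      using True by (simp add: flat_def power_add field_simps power2_eq_square)
    moreover have "fact (k + 2) * exp (1 / t) * (t\<^sup>2 * exp (- (1 / t))) = fact (k + 2) * t\<^sup>2"
      by (simp add: exp_minus del: fact_Suc)
    ultimately show ?thesis
      by argo
  qed (simp add: flat_def)
qed

lemma DERIV_flat: "(flat k has_real_derivative - real k * flat (Suc k) t + flat (k + 2) t) (at t)"
proof -
  consider "t < 0" | "t = 0" | "0 < t" by linarith
  then show ?thesis
  proof cases
    case 1
    have "((\<lambda>_. 0) has_real_derivative 0) (at t)" by simp
    then have "(flat k has_real_derivative 0) (at t)"
      by (rule has_field_derivative_transform_within_open[of _ _ _ "{..<0}"]) (use 1 in \<open>auto simp: flat_def\<close>)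
    then show ?thesis using 1 by (simp add: flat_def)
  next
    case 2
    \<comment> \<open>The quadratic bound makes the difference quotient at the origin tend to zero.\<close>
    have "((\<lambda>h. flat k h / h) \<longlongrightarrow> 0) (at 0)"
    proof (rule tendsto_0_le[where K=1])
      show "((\<lambda>h. fact (k + 2) * h) \<longlongrightarrow> (0::real)) (at 0)"
        by (auto intro!: tendsto_eq_intros)
      have "norm (flat k h / h) \<le> norm (fact (k + 2) * h) * 1" if "h \<noteq> 0" for h
      proof -
        have "flat k h / \<bar>h\<bar> \<le> fact (k + 2) * h\<^sup>2 / \<bar>h\<bar>"
          by (intro divide_right_mono flat_bounds) auto
        also have "\<dots> = fact (k + 2) * \<bar>h\<bar>"
          using that by (cases "0 < h") (auto simp: power2_eq_square)
        finally show ?thesis using flat_bounds(1)[of k h] by (simp add: abs_mult)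
      qed
      then show "\<forall>\<^sub>F h in at 0. norm (flat k h / h) \<le> norm (fact (k + 2) * h) * 1"
        by (auto simp: eventually_at_filter)
    qed
    then show ?thesis unfolding 2 has_field_derivative_iff by (simp add: flat_def)
  next
    case 3
    have "((\<lambda>t. (1 / t) ^ k * exp (- (1 / t))) has_real_derivative
        - real k * flat (Suc k) t + flat (k + 2) t) (at t)"
    proof -
      have inv: "((\<lambda>t. 1 / t) has_real_derivative - ((1 / t)\<^sup>2)) (at t)"
        using 3 by (auto intro!: derivative_eq_intros simp: power2_eq_square)
      have "((\<lambda>t. (1 / t) ^ k) has_real_derivative - real k * (1 / t) ^ Suc k) (at t)"
        by (rule DERIV_cong[OF DERIV_power[OF inv, of k]]) (cases k; simp add: power2_eq_square distrib_right left_diff_distrib diff_divide_distrib add_divide_distrib)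
      from DERIV_mult[OF this DERIV_exp[THEN DERIV_chain2, OF DERIV_minus[OF inv]]] show ?thesis
        by (rule DERIV_cong) (use 3 in \<open>simp add: flat_def power2_eq_square algebra_simps\<close>)
    qed
    then show ?thesis
      by (rule has_field_derivative_transform_within_open[of _ _ _ "{0<..}"]) (use 3 in \<open>auto simp: flat_def\<close>)
  qed
qed

text \<open>The predicate \<open>Ck_on\<close> recurses over directional derivatives.  A set of differentiable functions
  that is closed under directional derivatives therefore consists of functions of every class \<open>C\<^sup>k\<close>,
  and closing a few generators under sums, products and \<open>flat\<close> gives such a set with
  bump functions in it.\<close>

inductive_set smooth_terms :: "('a::real_inner \<Rightarrow> real) set" where
  const: "(\<lambda>_. c) \<in> smooth_terms"
| inner: "(\<lambda>x. x \<bullet> a) \<in> smooth_terms"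
| add: "f \<in> smooth_terms \<Longrightarrow> g \<in> smooth_terms \<Longrightarrow> (\<lambda>x. f x + g x) \<in> smooth_terms"
| mult: "f \<in> smooth_terms \<Longrightarrow> g \<in> smooth_terms \<Longrightarrow> (\<lambda>x. f x * g x) \<in> smooth_terms"
| flat: "f \<in> smooth_terms \<Longrightarrow> (\<lambda>x. flat k (f x)) \<in> smooth_terms"

lemma smooth_terms_derivative:
  assumes "f \<in> smooth_terms"
  shows "\<exists>D. (\<forall>x. (f has_derivative D x) (at x)) \<and> (\<forall>v. (\<lambda>x. D x v) \<in> smooth_terms)"
  using assms
proof induction
  case (const c)
  show ?case
    by (rule exI[of _ "\<lambda>_ _. 0"]) (auto intro: smooth_terms.const)
next
  case (inner a)
  show ?case
    by (rule exI[of _ "\<lambda>_ v. v \<bullet> a"]) (auto intro!: smooth_terms.const derivative_eq_intros)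
next
  case (add f g)
  then obtain D E where "\<And>x. (f has_derivative D x) (at x)" "\<And>v. (\<lambda>x. D x v) \<in> smooth_terms"
    "\<And>x. (g has_derivative E x) (at x)" "\<And>v. (\<lambda>x. E x v) \<in> smooth_terms" by blast
  then show ?case
    by (intro exI[of _ "\<lambda>x v. D x v + E x v"]) (auto intro!: smooth_terms.add has_derivative_add)
next
  case (mult f g)
  then obtain D E where "\<And>x. (f has_derivative D x) (at x)" "\<And>v. (\<lambda>x. D x v) \<in> smooth_terms"
    "\<And>x. (g has_derivative E x) (at x)" "\<And>v. (\<lambda>x. E x v) \<in> smooth_terms" by blast
  then show ?case
    by (intro exI[of _ "\<lambda>x v. f x * E x v + D x v * g x"])
      (auto intro!: smooth_terms.add smooth_terms.mult has_derivative_mult mult)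
next
  case (flat f k)
  then obtain D where D: "\<And>x. (f has_derivative D x) (at x)" "\<And>v. (\<lambda>x. D x v) \<in> smooth_terms"
    by blast
  let ?F = "\<lambda>x. - real k * flat (Suc k) (f x) + flat (k + 2) (f x)"
  have "((\<lambda>x. flat k (f x)) has_derivative (\<lambda>v. ?F x * D x v)) (at x)" for x
    using has_derivative_compose[OF D(1) DERIV_flat[unfolded has_field_derivative_def]] .
  moreover have "?F \<in> smooth_terms"
    by (intro smooth_terms.intros flat)
  ultimately show ?case
    by (intro exI[of _ "\<lambda>x v. ?F x * D x v"]) (auto intro!: smooth_terms.mult D)
qed

lemma smooth_terms_Ck_on: "f \<in> smooth_terms \<Longrightarrow> Ck_on k f UNIV"
proof (induction k arbitrary: f)
  case 0
  then obtain D where "\<And>x. (f has_derivative D x) (at x)"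
    using smooth_terms_derivative by blast
  then show ?case
    by (auto intro: continuous_at_imp_continuous_on has_derivative_continuous)
next
  case (Suc k)
  obtain D where D: "\<And>x. (f has_derivative D x) (at x)" "\<And>v. (\<lambda>x. D x v) \<in> smooth_terms"
    using smooth_terms_derivative[OF Suc.prems] by blast
  have "frechet_derivative f (at x) = D x" for x
    using frechet_derivative_at[OF D(1)] by simp
  then show ?case
    using D Suc.IH by (auto simp: differentiable_def)
qed

lemma smooth_terms_prod:
  "finite I \<Longrightarrow> (\<And>i. i \<in> I \<Longrightarrow> f i \<in> smooth_terms) \<Longrightarrow> (\<lambda>x. \<Prod>i\<in>I. f i x) \<in> smooth_terms"
  by (induction rule: finite_induct) (auto intro: smooth_terms.intros)

text \<open>The product \<open>\<beta>\<close> of one-sided flat functions is positive exactly on the open box, and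
  \<open>exp (- 1 / (m \<beta>))\<close> increases to \<open>1\<close> wherever \<open>\<beta>\<close> is positive.\<close>

lemma box_indicator_approx:
  fixes a b :: "real^'n"
  assumes "cbox a b \<subseteq> \<Omega>"
  obtains h where "\<And>m::nat. h m \<in> test_functions \<Omega>" "\<And>m x. \<bar>h m x\<bar> \<le> indicator (box a b) x"
    "\<And>x. (\<lambda>m. h m x) \<longlonglongrightarrow> indicator (box a b) x"
proof -
  define \<beta> where "\<beta> = (\<lambda>x. \<Prod>i\<in>Basis. flat 0 (x \<bullet> i + - (a \<bullet> i)) * flat 0 (b \<bullet> i + (x \<bullet> i) * (-1)))"
  define h where "h m x = flat 0 (real m * \<beta> x)" for m x
  have flat0: "0 < flat 0 t \<longleftrightarrow> 0 < t" "flat 0 t = 0 \<longleftrightarrow> t \<le> 0" for t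
    by (auto simp: flat_def)
  have \<beta>_pos: "0 < \<beta> x" if "x \<in> box a b" for x
    using that unfolding \<beta>_def by (intro prod_pos) (auto simp: mem_box flat0 intro!: mult_pos_pos)
  have \<beta>_zero: "\<beta> x = 0" if "x \<notin> box a b" for x
  proof -
    have "\<exists>i\<in>Basis. x \<bullet> i \<le> a \<bullet> i \<or> b \<bullet> i \<le> x \<bullet> i"
      using that unfolding mem_box by (simp add: not_less Bex_def)
    then obtain i where "i \<in> Basis" "x \<bullet> i \<le> a \<bullet> i \<or> b \<bullet> i \<le> x \<bullet> i"
      by blast
    then have "flat 0 (x \<bullet> i + - (a \<bullet> i)) * flat 0 (b \<bullet> i + (x \<bullet> i) * (-1)) = 0"
      by (auto simp: flat_def)
    then show ?thesis unfolding \<beta>_def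
      using \<open>i \<in> Basis\<close> by (intro prod_zero) auto
  qed
  have smooth: "h m \<in> smooth_terms" for m
    unfolding h_def[abs_def] \<beta>_def by (intro smooth_terms.intros smooth_terms_prod) auto
  have supp: "{x. h m x \<noteq> 0} \<subseteq> box a b" for m
    using \<beta>_zero by (force simp: h_def flat_def)
  have cl: "closure {x. h m x \<noteq> 0} \<subseteq> cbox a b" for m
    using supp[of m] box_subset_cbox[of a b] by (intro closure_minimal closed_cbox) auto
  show ?thesis
  proof
    have "compact (closure {x. h m x \<noteq> 0})" for m
      using cl compact_cbox by (metis bounded_subset closed_closure compact_imp_bounded compact_eq_bounded_closed)
    then show "h m \<in> test_functions \<Omega>" for m
      using smooth_terms_Ck_on[OF smooth] cl[of m] assms unfolding test_functions_def by blast
    show "\<bar>h m x\<bar> \<le> indicator (box a b) x" for m x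
      using \<beta>_zero[of x] by (auto simp: h_def flat_def split: split_indicator)
    show "(\<lambda>m. h m x) \<longlonglongrightarrow> indicator (box a b) x" for x
    proof (cases "x \<in> box a b")
      case True
      have "(\<lambda>m. exp (- (inverse (\<beta> x) / real m))) \<longlonglongrightarrow> exp (- 0)"
        by (intro tendsto_intros lim_const_over_n)
      moreover have "\<forall>\<^sub>F m in sequentially. exp (- (inverse (\<beta> x) / real m)) = h m x"
        using eventually_gt_at_top[of 0] by eventually_elim
          (use \<beta>_pos[OF True] in \<open>auto simp: h_def flat_def field_simps\<close>)
      ultimately show ?thesis
        using True by (auto intro: Lim_transform_eventually)
    qed (simp add: h_def \<beta>_zero flat_def)
  qed
qed


section \<open>The fundamental lemma of the calculus of variations\<close>

text \<open>An open set is a countable union of closed boxes, and the boundary of a box is a null set.\<close>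

lemma open_locally_AE:
  fixes \<Omega> :: "(real^'n) set"
  assumes "open \<Omega>" and "\<And>a b. cbox a b \<subseteq> \<Omega> \<Longrightarrow> AE x in lborel. x \<in> box a b \<longrightarrow> P x"
  shows "AE x in lborel. x \<in> \<Omega> \<longrightarrow> P x"
proof -
  obtain \<D> where \<D>: "countable \<D>" "\<D> \<subseteq> Pow \<Omega>" "\<And>X. X \<in> \<D> \<Longrightarrow> \<exists>a b. X = cbox a b" "\<Union>\<D> = \<Omega>"
    using open_countable_Union_open_cbox[OF assms(1)] by metis
  have "AE x in lborel. x \<in> X \<longrightarrow> P x" if X: "X \<in> \<D>" for X
  proof -
    obtain a b where X: "X = cbox a b" "cbox a b \<subseteq> \<Omega>"
      using \<D>(2) \<D>(3)[OF X] X by blast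
    have "emeasure lborel (cbox a b - box a b) = emeasure lborel (cbox a b) - emeasure lborel (box a b)"
      by (intro emeasure_Diff) (auto simp: emeasure_lborel_box_eq box_subset_cbox)
    also have "\<dots> = 0"
      by (auto simp: emeasure_lborel_cbox_eq emeasure_lborel_box_eq)
    finally have "emeasure lborel (cbox a b - box a b) = 0" .
    then have "AE x in lborel. x \<notin> cbox a b - box a b"
      by (intro AE_not_in) (auto simp: null_sets_def)
    with assms(2)[OF X(2)] show ?thesis
      by eventually_elim (auto simp: X(1))
  qed
  then have "AE x in lborel. \<forall>X\<in>\<D>. x \<in> X \<longrightarrow> P x"
    using \<D>(1) by (subst AE_ball_countable) auto
  then show ?thesis
    unfolding \<D>(4)[symmetric] by eventually_elim blast
qed

text \<open>Dominated convergence along smooth approximations turns the hypothesis into vanishing integrals of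
  \<open>g\<close> over all boxes whose closure lies in \<open>\<Omega>\<close>.  Inside a fixed one of these the boxes generate the Borel
  sets and are stable under intersection, so the integral of \<open>g\<close> over every Borel subset vanishes.\<close>

lemma fundamental_lemma:
  fixes g :: "real^'n \<Rightarrow> 'b::{banach, second_countable_topology}"
  assumes \<Omega>: "open \<Omega>" and g: "locally_integrable \<Omega> g"
    and zero: "\<And>h. h \<in> test_functions \<Omega> \<Longrightarrow> (LINT x:\<Omega>|lborel. h x *\<^sub>R g x) = 0"
  shows "AE x in lborel. x \<in> \<Omega> \<longrightarrow> g x = 0"
proof (rule open_locally_AE[OF \<Omega>])
  fix a b assume ab: "cbox a b \<subseteq> \<Omega>"
  define G where "G x = indicator (box a b) x *\<^sub>R g x" for x
  have int_cbox: "set_integrable lborel (cbox a b) g"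
    using g ab by (auto simp: locally_integrable_def)
  then have int_G: "integrable lborel G"
    using set_integrable_subset[OF int_cbox _ box_subset_cbox] by (simp add: G_def[abs_def] set_integrable_def)
  have box_zero: "(LINT x:box c d|lborel. G x) = 0" for c d
  proof (cases "box c d \<inter> box a b = {}")
    case True
    then have "indicator (box c d) x *\<^sub>R G x = (0::'b)" for x
      by (auto simp: G_def split: split_indicator)
    then show ?thesis unfolding set_lebesgue_integral_def by (simp only: Bochner_Integration.integral_zero)
  next
    case False
    obtain c' d' where cd: "box c d \<inter> box a b = box c' d'"
      unfolding box_Int_box by blast
    \<comment> \<open>Only a nonempty open box has the corresponding closed box as its closure.\<close>
    have "cbox c' d' = closure (box c d \<inter> box a b)"
      using False by (simp add: cd closure_box)
    also have "\<dots> \<subseteq> cbox a b"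
      by (rule closure_minimal) (use box_subset_cbox[of a b] in auto)
    finally have cd_sub: "cbox c' d' \<subseteq> cbox a b" .
    obtain h where h: "\<And>m::nat. h m \<in> test_functions \<Omega>" "\<And>m x. \<bar>h m x\<bar> \<le> indicator (box c' d') x"
      "\<And>x. (\<lambda>m. h m x) \<longlonglongrightarrow> indicator (box c' d') x"
      using box_indicator_approx[of c' d' \<Omega>] cd_sub ab by blast
    have sub: "box c' d' \<subseteq> box a b" "box c' d' \<subseteq> \<Omega>"
      using cd box_subset_cbox[of c' d'] cd_sub ab by auto
    have eq: "indicator \<Omega> x *\<^sub>R (h m x *\<^sub>R g x) = h m x *\<^sub>R G x" for m x
    proof (cases "x \<in> box c' d'")
      case False
      then have "h m x = 0" using h(2)[of m x] by simp
      then show ?thesis by simp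
    qed (use sub in \<open>simp add: G_def indicator_def subset_iff\<close>)
    have hm: "h m \<in> borel_measurable lborel" for m
    proof -
      have "Ck_on 0 (h m) UNIV" using h(1) unfolding test_functions_def by blast
      then show ?thesis by (simp add: borel_measurable_continuous_onI)
    qed
    have "(\<lambda>m. LINT x|lborel. h m x *\<^sub>R G x) \<longlonglongrightarrow> (LINT x|lborel. indicator (box c' d') x *\<^sub>R G x)"
    proof (rule integral_dominated_convergence)
      show "integrable lborel (\<lambda>x. norm (G x))" using int_G by simp
      show "AE x in lborel. norm (h m x *\<^sub>R G x) \<le> norm (G x)" for m
      proof (rule AE_I2)
        fix x
        have "\<bar>h m x\<bar> \<le> 1"
          by (rule order_trans[OF h(2)]) (simp add: indicator_def)
        then show "norm (h m x *\<^sub>R G x) \<le> norm (G x)"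
          by (simp add: mult_left_le_one_le)
      qed
    qed (use int_G hm h(3) in \<open>auto intro!: tendsto_scaleR\<close>)
    moreover have "(LINT x|lborel. h m x *\<^sub>R G x) = 0" for m
      using zero[OF h(1)[of m]] by (simp only: set_lebesgue_integral_def eq)
    ultimately have "(LINT x|lborel. indicator (box c' d') x *\<^sub>R G x) = 0"
      by (simp add: LIMSEQ_const_iff)
    also have "(\<lambda>x. indicator (box c' d') x *\<^sub>R G x) = (\<lambda>x. indicator (box c d) x *\<^sub>R G x)"
      unfolding cd[symmetric] by (auto simp: G_def split: split_indicator)
    finally show ?thesis by (simp add: set_lebesgue_integral_def)
  qed
  have "indicator (box a b) x *\<^sub>R G x = indicator UNIV x *\<^sub>R G x" for x
    by (auto simp: G_def split: split_indicator)
  then have UNIV_zero: "(LINT x:UNIV|lborel. G x) = 0"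
    using box_zero[of a b] by (simp only: set_lebesgue_integral_def)
  have all_zero: "(LINT x:A|lborel. G x) = 0" if A: "A \<in> sets borel" for A
  proof -
    have "Int_stable (range (\<lambda>(a, b). box a b :: (real^'n) set))"
      by (auto simp: Int_stable_def box_Int_box)
    moreover have "range (\<lambda>(a, b). box a b :: (real^'n) set) \<subseteq> Pow UNIV" by auto
    moreover have "A \<in> sigma_sets UNIV (range (\<lambda>(a, b). box a b))"
      using A unfolding borel_eq_box by simp
    ultimately show ?thesis
    proof (induction rule: sigma_sets_induct_disjoint)
      case (compl A)
      then have [measurable]: "A \<in> sets borel" by (simp add: borel_eq_box)
      have "(LINT x:A \<union> (UNIV - A)|lborel. G x) = (LINT x:A|lborel. G x) + (LINT x:UNIV - A|lborel. G x)"
        using int_G by (intro set_integral_Un) (auto simp: set_integrable_def intro: integrable_mult_indicator)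
      then show ?case using UNIV_zero compl.IH by simp
    next
      case (union F)
      then have [measurable]: "F i \<in> sets borel" for i by (auto simp add: borel_eq_box)
      have "(LINT x:(\<Union>i. F i)|lborel. G x) = (\<Sum>i. (LINT x:(F i)|lborel. G x))"
        using union int_G by (intro lebesgue_integral_countable_add)
          (auto simp: set_integrable_def disjoint_family_on_def intro: integrable_mult_indicator)
      then show ?case using union.IH by simp
    next
      case empty
      then show ?case by (simp add: set_lebesgue_integral_def)
    qed (auto simp: box_zero)
  qed
  have "AE x in lborel. G x = 0"
    by (rule sigma_finite_measure.density_zero[OF sigma_finite_lborel int_G]) (simp add: all_zero)
  then show "AE x in lborel. x \<in> box a b \<longrightarrow> g x = 0"
    by eventually_elim (auto simp: G_def)
qed


section \<open>Integration by parts\<close>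

lemma Ck_on_1_grad:
  fixes h :: "real^'n \<Rightarrow> real"
  assumes "Ck_on 1 h UNIV"
  shows "(h has_derivative (\<lambda>v. grad h x \<bullet> v)) (at x)" "continuous_on UNIV (grad h)" "continuous_on UNIV h"
proof -
  have diff: "h differentiable (at x)" for x
    using assms by simp
  have "frechet_derivative h (at x) v = grad h x \<bullet> v" for v
  proof -
    have lin: "linear (frechet_derivative h (at x))"
      using diff by (rule linear_frechet_derivative)
    have "frechet_derivative h (at x) v = frechet_derivative h (at x) (\<Sum>i\<in>UNIV. v $ i *s axis i 1)"
      by (simp add: basis_expansion)
    also have "\<dots> = (\<Sum>i\<in>UNIV. v $ i * frechet_derivative h (at x) (axis i 1))"
      by (simp add: linear_sum[OF lin] linear_cmul[OF lin] scalar_mult_eq_scaleR)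
    also have "\<dots> = grad h x \<bullet> v"
      by (simp add: grad_def inner_vec_def mult.commute)
    finally show ?thesis .
  qed
  then have "frechet_derivative h (at x) = (\<lambda>v. grad h x \<bullet> v)" by auto
  then show "(h has_derivative (\<lambda>v. grad h x \<bullet> v)) (at x)"
    using diff[of x] by (metis frechet_derivative_works)
  show "continuous_on UNIV (grad h)"
    unfolding grad_def[abs_def] using assms by (intro continuous_on_vec_lambda) simp
  show "continuous_on UNIV h"
    using diff by (auto intro!: continuous_at_imp_continuous_on differentiable_imp_continuous_within)
qed

lemma grad_eqI:
  fixes h :: "real^'n \<Rightarrow> real"
  assumes "(h has_derivative (\<lambda>v. g \<bullet> v)) (at x)"
  shows "grad h x = g"
  using frechet_derivative_at[OF assms, symmetric]
  by (simp add: grad_def vec_eq_iff inner_axis)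

lemma grad_zero_outside_support:
  fixes h :: "real^'n \<Rightarrow> real"
  assumes "closed K" "\<And>x. x \<notin> K \<Longrightarrow> h x = 0" "x \<notin> K"
  shows "grad h x = 0"
proof (rule grad_eqI)
  have "((\<lambda>_. 0) has_derivative (\<lambda>v. 0 \<bullet> v)) (at x)" by simp
  then show "(h has_derivative (\<lambda>v. 0 \<bullet> v)) (at x)"
    by (rule has_derivative_transform_within_open[of _ _ _ _ "- K"]) (use assms in auto)
qed

lemma test_function_Ck_on_1: "h \<in> test_functions \<Omega> \<Longrightarrow> Ck_on 1 h UNIV"
  unfolding test_functions_def by blast

lemma test_function_support:
  assumes "h \<in> test_functions \<Omega>"
  shows "\<exists>K. compact K \<and> K \<subseteq> \<Omega> \<and> (\<forall>x. x \<notin> K \<longrightarrow> h x = 0) \<and> (\<forall>x. x \<notin> K \<longrightarrow> grad h x = 0)"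
proof (intro exI conjI allI impI)
  let ?K = "closure {x. h x \<noteq> 0}"
  show "compact ?K" "?K \<subseteq> \<Omega>"
    using assms unfolding test_functions_def by blast+
  show *: "h x = 0" if "x \<notin> ?K" for x
    using that closure_subset[of "{x. h x \<noteq> 0}"] by blast
  show "grad h x = 0" if "x \<notin> ?K" for x
    by (rule grad_zero_outside_support[OF closed_closure * that])
qed

lemma test_functions_mono: "\<Omega> \<subseteq> \<Omega>' \<Longrightarrow> test_functions \<Omega> \<subseteq> test_functions \<Omega>'"
  unfolding test_functions_def by blast

lemma compact_support_bounded:
  fixes f :: "'a::metric_space \<Rightarrow> 'b::real_normed_vector"
  assumes "continuous_on UNIV f" "compact K" "\<And>x. x \<notin> K \<Longrightarrow> f x = 0"
  obtains C where "0 < C" "\<And>x. norm (f x) \<le> C"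
proof -
  have "bounded (f ` K)"
    using compact_continuous_image[OF continuous_on_subset[OF assms(1)] assms(2)] compact_imp_bounded by blast
  then obtain C where C: "0 < C" "\<And>x. x \<in> K \<Longrightarrow> norm (f x) \<le> C"
    by (auto simp: bounded_pos)
  then have "norm (f x) \<le> C" for x
    using assms(3)[of x] by (cases "x \<in> K") auto
  with C(1) show ?thesis by (rule that)
qed

lemma lipschitz_of_grad_bound:
  fixes F :: "real^'n \<Rightarrow> real"
  assumes "Ck_on 1 F UNIV" "\<And>x. norm (grad F x) \<le> C"
  shows "\<bar>F y - F x\<bar> \<le> C * norm (y - x)"
proof -
  have "norm (F y - F x) \<le> C * norm (y - x)"
  proof (rule differentiable_bound[of UNIV])
    show "(F has_derivative (\<lambda>v. grad F z \<bullet> v)) (at z within UNIV)" for z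
      using Ck_on_1_grad(1)[OF assms(1)] by simp
    show "onorm (\<lambda>v. grad F z \<bullet> v) \<le> C" for z
    proof (rule onorm_le)
      fix v
      have "norm (grad F z \<bullet> v) \<le> norm (grad F z) * norm v" by (simp add: Cauchy_Schwarz_ineq2)
      also have "\<dots> \<le> C * norm v" by (intro mult_right_mono assms(2)) simp
      finally show "norm (grad F z \<bullet> v) \<le> C * norm v" .
    qed
  qed auto
  then show ?thesis by simp
qed

text \<open>Differentiation under the integral sign.  With \<open>v\<close> the indicator of a large ball this shows that
  gradients of compactly supported functions have integral zero; with \<open>v\<close> extended by zero from a
  bounded domain it shows that a function with vanishing gradient is orthogonal to test functions.\<close>

lemma derivative_integral_translate:
  fixes F v :: "real^'n \<Rightarrow> real"
  assumes v: "integrable lborel v"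
    and F: "Ck_on 1 F UNIV" and K: "compact K" "\<And>x. x \<notin> K \<Longrightarrow> F x = 0"
  shows "((\<lambda>t. LINT x|lborel. v x * F (x + t *\<^sub>R e)) has_real_derivative
          (LINT x|lborel. v x * (grad F (x + t *\<^sub>R e) \<bullet> e))) (at t)"
proof -
  have cont: "continuous_on UNIV F" "continuous_on UNIV (grad F)"
    using Ck_on_1_grad[OF F] by auto
  have [measurable]: "F \<in> borel_measurable borel" "grad F \<in> borel_measurable borel"
    using cont by (auto intro: borel_measurable_continuous_onI)
  have [measurable]: "v \<in> borel_measurable borel"
    using borel_measurable_integrable[OF v] by simp
  obtain B where B: "0 < B" "\<And>x. norm (F x) \<le> B"
    using compact_support_bounded[OF cont(1) K] by blast
  obtain C where C: "0 < C" "\<And>x. norm (grad F x) \<le> C"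
    using compact_support_bounded[OF cont(2) K(1) grad_zero_outside_support[OF compact_imp_closed[OF K(1)] K(2)]]
    by blast
  have int: "integrable lborel (\<lambda>x. v x * F (x + s *\<^sub>R e))" for s
  proof (rule Bochner_Integration.integrable_bound)
    show "integrable lborel (\<lambda>x. B * v x)" using v by simp
    show "AE x in lborel. norm (v x * F (x + s *\<^sub>R e)) \<le> norm (B * v x)"
      using B by (intro AE_I2) (simp add: abs_mult mult.commute[of B] mult_left_mono)
  qed measurable
  let ?G = "\<lambda>t. LINT x|lborel. v x * F (x + t *\<^sub>R e)"
  show ?thesis
    unfolding DERIV_def tendsto_at_iff_sequentially
  proof (intro allI impI)
    fix s :: "nat \<Rightarrow> real" assume s: "\<forall>i. s i \<in> UNIV - {0}" "s \<longlonglongrightarrow> 0"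
    \<comment> \<open>The difference quotients of F are bounded by its Lipschitz constant, so a multiple of v dominates.\<close>
    let ?q = "\<lambda>i x. v x * ((F (x + (t + s i) *\<^sub>R e) - F (x + t *\<^sub>R e)) / s i)"
    have "(\<lambda>i. LINT x|lborel. ?q i x) \<longlonglongrightarrow> (LINT x|lborel. v x * (grad F (x + t *\<^sub>R e) \<bullet> e))"
    proof (rule integral_dominated_convergence)
      show "integrable lborel (\<lambda>x. C * norm e * \<bar>v x\<bar>)" using v by simp
      show "AE x in lborel. (\<lambda>i. ?q i x) \<longlonglongrightarrow> v x * (grad F (x + t *\<^sub>R e) \<bullet> e)"
      proof (intro AE_I2 tendsto_mult tendsto_const)
        fix x
        have "((\<lambda>r. x + r *\<^sub>R e) has_derivative (\<lambda>r. r *\<^sub>R e)) (at t)"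
          by (auto intro!: derivative_eq_intros)
        from has_derivative_compose[OF this Ck_on_1_grad(1)[OF F]]
        have "((\<lambda>r. F (x + r *\<^sub>R e)) has_real_derivative grad F (x + t *\<^sub>R e) \<bullet> e) (at t)"
          by (simp add: has_field_derivative_def mult_commute_abs)
        then show "(\<lambda>i. (F (x + (t + s i) *\<^sub>R e) - F (x + t *\<^sub>R e)) / s i) \<longlonglongrightarrow> grad F (x + t *\<^sub>R e) \<bullet> e"
          using s unfolding DERIV_def tendsto_at_iff_sequentially by (auto simp: comp_def)
      qed
      show "AE x in lborel. norm (?q i x) \<le> C * norm e * \<bar>v x\<bar>" for i
      proof (rule AE_I2)
        fix x
        have "\<bar>F (x + (t + s i) *\<^sub>R e) - F (x + t *\<^sub>R e)\<bar> \<le> C * (\<bar>s i\<bar> * norm e)"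
          using lipschitz_of_grad_bound[OF F C(2), where x = "x + t *\<^sub>R e" and y = "x + (t + s i) *\<^sub>R e"]
          by (simp add: scaleR_left_distrib)
        then have "\<bar>(F (x + (t + s i) *\<^sub>R e) - F (x + t *\<^sub>R e)) / s i\<bar> \<le> C * norm e"
          using s(1) by (simp add: abs_div field_simps)
        then show "norm (?q i x) \<le> C * norm e * \<bar>v x\<bar>"
          unfolding real_norm_def abs_mult mult.commute[of "C * norm e"] by (rule mult_left_mono) simp
      qed
    qed measurable
    moreover have "(LINT x|lborel. ?q i x) = (?G (t + s i) - ?G t) / s i" for i
    proof -
      have "(LINT x|lborel. ?q i x) = (LINT x|lborel. (v x * F (x + (t + s i) *\<^sub>R e) - v x * F (x + t *\<^sub>R e)) / s i)"
        by (simp add: right_diff_distrib)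
      also have "\<dots> = (?G (t + s i) - ?G t) / s i"
        using int by simp
      finally show ?thesis .
    qed
    ultimately show "((\<lambda>h. (?G (t + h) - ?G t) / h) \<circ> s) \<longlonglongrightarrow> (LINT x|lborel. v x * (grad F (x + t *\<^sub>R e) \<bullet> e))"
      by (simp only: comp_def)
  qed
qed

lemma integrable_compact_support:
  fixes f :: "real^'n \<Rightarrow> 'b::{banach, second_countable_topology}"
  assumes "continuous_on UNIV f" "compact K" "\<And>x. x \<notin> K \<Longrightarrow> f x = 0"
  shows "integrable lborel f"
proof -
  have "integrable lborel (\<lambda>x. indicator K x *\<^sub>R f x)"
    using borel_integrable_compact[OF assms(2) continuous_on_subset[OF assms(1)]] 
    by (simp add: set_integrable_def)
  moreover have "(\<lambda>x. indicator K x *\<^sub>R f x) = f"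
    using assms(3) by (auto simp: fun_eq_iff indicator_def)
  ultimately show ?thesis by simp
qed

text \<open>By translation invariance of Lebesgue measure, \<open>t \<mapsto> \<integral> F (x + t e) dx\<close> is constant.\<close>

lemma integral_grad_compact_support:
  fixes F :: "real^'n \<Rightarrow> real"
  assumes F: "Ck_on 1 F UNIV" and K: "compact K" "\<And>x. x \<notin> K \<Longrightarrow> F x = 0"
  shows "(LINT x|lborel. grad F x) = 0"
proof -
  have gradK: "grad F x = 0" if "x \<notin> K" for x
    by (rule grad_zero_outside_support[OF compact_imp_closed[OF K(1)] K(2) that])
  have int: "integrable lborel (grad F)"
    using integrable_compact_support[OF Ck_on_1_grad(2)[OF F] K(1) gradK] .
  have [measurable]: "F \<in> borel_measurable borel"
    using Ck_on_1_grad(3)[OF F] by (rule borel_measurable_continuous_onI)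
  have "(LINT x|lborel. grad F x) \<bullet> e = 0" for e
  proof -
    obtain R where R: "K \<subseteq> ball 0 R"
      using compact_imp_bounded[OF K(1)] bounded_subset_ballD by blast
    \<comment> \<open>The cutoff v makes the integrand a multiple of an integrable function; it equals 1 on the support of every translate by \<open>t e\<close> with \<open>\<bar>t\<bar> < 1\<close>.\<close>
    define v :: "real^'n \<Rightarrow> real" where "v = indicator (ball 0 (R + norm e))"
    have v: "integrable lborel v"
      unfolding v_def by (intro integrable_real_indicator) (simp_all add: emeasure_bounded_finite[OF bounded_ball, simplified])
    have const: "(LINT x|lborel. v x * F (x + t *\<^sub>R e)) = (LINT x|lborel. F x)" if "t \<in> {-1<..<1}" for t
    proof -
      have eq: "v x * F (x + t *\<^sub>R e) = F (x + t *\<^sub>R e)" for x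
      proof (cases "F (x + t *\<^sub>R e) = 0")
        case False
        then have "norm (x + t *\<^sub>R e) < R" using K(2) R by force
        moreover have "norm x \<le> norm (x + t *\<^sub>R e) + norm (t *\<^sub>R e)"
          using norm_triangle_ineq4[of "x + t *\<^sub>R e" "t *\<^sub>R e"] by simp
        moreover have "norm (t *\<^sub>R e) \<le> norm e"
          using that by (auto intro!: mult_left_le_one_le)
        ultimately show ?thesis by (simp add: v_def)
      qed simp
      have "(LINT x|lborel. F (x + t *\<^sub>R e)) = (LINT x|distr lborel borel ((+) (t *\<^sub>R e)). F x)"
        by (subst integral_distr) (auto simp: add.commute)
      then show ?thesis by (simp only: eq lborel_distr_plus)
    qed
    have "((\<lambda>t. LINT x|lborel. v x * F (x + t *\<^sub>R e)) has_real_derivative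
          (LINT x|lborel. v x * (grad F (x + 0 *\<^sub>R e) \<bullet> e))) (at 0)"
      by (rule derivative_integral_translate[OF v F K])
    moreover have "((\<lambda>t. LINT x|lborel. v x * F (x + t *\<^sub>R e)) has_real_derivative 0) (at 0)"
      by (rule has_field_derivative_transform_within_open[where f = "\<lambda>_. LINT x|lborel. F x" and S = "{-1<..<1}"])
        (auto simp: const)
    ultimately have "(LINT x|lborel. v x * (grad F x \<bullet> e)) = 0"
      using DERIV_unique by fastforce
    moreover have "v x * (grad F x \<bullet> e) = grad F x \<bullet> e" for x
    proof (cases "x \<in> K")
      case True
      then have "norm x < R + norm e" using R norm_ge_zero[of e] by (force simp del: norm_ge_zero)
      then show ?thesis by (simp add: v_def)
    qed (simp add: gradK)
    ultimately show ?thesis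
      using int by simp
  qed
  then show ?thesis by (metis inner_eq_zero_iff)
qed


lemma Ck_on_1_mult:
  fixes h k :: "real^'n \<Rightarrow> real"
  assumes h: "Ck_on 1 h UNIV" and k: "Ck_on 1 k UNIV"
  shows "Ck_on 1 (\<lambda>x. h x * k x) UNIV"
    and "grad (\<lambda>x. h x * k x) x = h x *\<^sub>R grad k x + k x *\<^sub>R grad h x"
proof -
  have D: "((\<lambda>x. h x * k x) has_derivative (\<lambda>v. (h x *\<^sub>R grad k x + k x *\<^sub>R grad h x) \<bullet> v)) (at x)" for x
    by (rule has_derivative_eq_rhs[OF has_derivative_mult[OF Ck_on_1_grad(1)[OF h] Ck_on_1_grad(1)[OF k]]])
      (simp add: fun_eq_iff inner_add_left mult_ac)
  have cont: "continuous_on UNIV (\<lambda>x. (h x *\<^sub>R grad k x + k x *\<^sub>R grad h x) \<bullet> v)" for v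
    by (intro continuous_intros Ck_on_1_grad[OF h] Ck_on_1_grad[OF k])
  have "frechet_derivative (\<lambda>x. h x * k x) (at x) v = (h x *\<^sub>R grad k x + k x *\<^sub>R grad h x) \<bullet> v" for x v
    using frechet_derivative_at[OF D, of x, symmetric] by simp
  then show "Ck_on 1 (\<lambda>x. h x * k x) UNIV"
    using D cont by (auto simp: differentiable_def)
  show "grad (\<lambda>x. h x * k x) x = h x *\<^sub>R grad k x + k x *\<^sub>R grad h x"
    by (rule grad_eqI[OF D])
qed

text \<open>The factor \<open>k\<close> may be arbitrary near the boundary of \<open>\<Omega>\<close>; this is what distinguishes limits of test
  functions from general Sobolev functions.\<close>

lemma integral_by_parts:
  fixes h k :: "real^'n \<Rightarrow> real"
  assumes h: "h \<in> test_functions \<Omega>" and k: "Ck_on 1 k UNIV"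
  shows "(LINT x:\<Omega>|lborel. h x *\<^sub>R grad k x) = - (LINT x:\<Omega>|lborel. k x *\<^sub>R grad h x)"
proof -
  obtain K where K: "compact K" "K \<subseteq> \<Omega>" "\<And>x. x \<notin> K \<Longrightarrow> h x = 0" "\<And>x. x \<notin> K \<Longrightarrow> grad h x = 0"
    using test_function_support[OF h] by blast
  note h1 = test_function_Ck_on_1[OF h]
  note c = Ck_on_1_grad(2,3)[OF h1] Ck_on_1_grad(2,3)[OF k]
  have int: "integrable lborel (\<lambda>x. h x *\<^sub>R grad k x)" "integrable lborel (\<lambda>x. k x *\<^sub>R grad h x)"
    by (rule integrable_compact_support[OF _ K(1)]; use K c in \<open>auto intro!: continuous_intros\<close>)+
  have "(LINT x|lborel. h x *\<^sub>R grad k x + k x *\<^sub>R grad h x) = 0"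
    using integral_grad_compact_support[OF Ck_on_1_mult(1)[OF h1 k] K(1)] K(3)
    by (simp add: Ck_on_1_mult(2)[OF h1 k])
  then have "(LINT x|lborel. h x *\<^sub>R grad k x) = - (LINT x|lborel. k x *\<^sub>R grad h x)"
    using int by (simp add: eq_neg_iff_add_eq_0)
  moreover have "indicator \<Omega> x *\<^sub>R (h x *\<^sub>R grad k x) = h x *\<^sub>R grad k x"
    "indicator \<Omega> x *\<^sub>R (k x *\<^sub>R grad h x) = k x *\<^sub>R grad h x" for x
    using K by (cases "x \<in> K"; auto)+
  ultimately show ?thesis
    by (simp only: set_lebesgue_integral_def)
qed

section \<open>Weak gradients\<close>

lemma integrable_bounded_scaleR:
  fixes f :: "'a \<Rightarrow> 'b::{banach, second_countable_topology}" and k :: "'a \<Rightarrow> real"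
  assumes f: "integrable M f" and k: "k \<in> borel_measurable M" "\<And>x. \<bar>k x\<bar> \<le> C"
  shows "integrable M (\<lambda>x. k x *\<^sub>R f x)"
proof (rule Bochner_Integration.integrable_bound)
  show "integrable M (\<lambda>x. C *\<^sub>R f x)"
    by (rule integrable_scaleR_right) (rule f)
  show "AE x in M. norm (k x *\<^sub>R f x) \<le> norm (C *\<^sub>R f x)"
  proof (rule AE_I2)
    fix x
    show "norm (k x *\<^sub>R f x) \<le> norm (C *\<^sub>R f x)"
      unfolding norm_scaleR using k(2)[of x] by (intro mult_right_mono) auto
  qed
qed (use borel_measurable_integrable[OF f] k(1) in measurable)

lemma integrable_scaleR_bounded:
  fixes f :: "'a \<Rightarrow> real" and k :: "'a \<Rightarrow> 'b::{banach, second_countable_topology}"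
  assumes f: "integrable M f" and k: "k \<in> borel_measurable M" "\<And>x. norm (k x) \<le> C"
  shows "integrable M (\<lambda>x. f x *\<^sub>R k x)"
proof (rule Bochner_Integration.integrable_bound)
  show "integrable M (\<lambda>x. C *\<^sub>R f x)"
    by (rule integrable_scaleR_right) (rule f)
  show "AE x in M. norm (f x *\<^sub>R k x) \<le> norm (C *\<^sub>R f x)"
  proof (rule AE_I2)
    fix x
    have "norm (k x) \<le> \<bar>C\<bar>" using k(2)[of x] by simp
    then show "norm (f x *\<^sub>R k x) \<le> norm (C *\<^sub>R f x)"
      by (simp add: abs_mult mult.commute[of "\<bar>C\<bar>"] mult_left_mono)
  qed
qed (use borel_measurable_integrable[OF f] k(1) in measurable)

text \<open>The open set is an increasing union of compact sets, on each of which \<open>f\<close> is integrable.\<close>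

lemma locally_integrable_measurable:
  fixes f :: "real^'n \<Rightarrow> 'b::{banach, second_countable_topology}"
  assumes "open \<Omega>" "locally_integrable \<Omega> f"
  shows "set_borel_measurable borel \<Omega> f"
proof -
  obtain C :: "nat \<Rightarrow> (real^'n) set" where C: "\<And>n. compact (C n)" "\<And>n. C n \<subseteq> \<Omega>"
    "\<And>n. C n \<subseteq> interior (C (Suc n))" "\<Union>(range C) = \<Omega>"
    using open_Union_compact_subsets[OF assms(1)] by metis
  have inc: "incseq C"
    using C(3) interior_subset by (intro incseq_SucI) blast
  have [measurable]: "(\<lambda>x. indicator (C n) x *\<^sub>R f x) \<in> borel_measurable borel" for n
  proof -
    have "set_integrable lborel (C n) f"
      using assms(2) C(1,2) by (simp add: locally_integrable_def)
    from borel_measurable_integrable[OF this[unfolded set_integrable_def]] show ?thesis by simp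
  qed
  have "(\<lambda>x. indicator \<Omega> x *\<^sub>R f x) \<in> borel_measurable borel"
  proof (rule borel_measurable_LIMSEQ_metric)
    show "(\<lambda>n. indicator (C n) x *\<^sub>R f x) \<longlonglongrightarrow> indicator \<Omega> x *\<^sub>R f x" for x
      using LIMSEQ_indicator_incseq[OF inc, of x] C(4) by (auto intro!: tendsto_scaleR)
  qed measurable
  then show ?thesis by (simp add: set_borel_measurable_def)
qed

lemma locally_integrable_lincomb:
  "locally_integrable \<Omega> f \<Longrightarrow> locally_integrable \<Omega> g \<Longrightarrow> locally_integrable \<Omega> (\<lambda>x. a *\<^sub>R f x + b *\<^sub>R g x)"
  unfolding locally_integrable_def by (auto intro!: set_integral_add)

lemma is_weak_gradient_integrable:
  assumes "is_weak_gradient \<Omega> u g" "h \<in> test_functions \<Omega>"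
  shows "set_integrable lborel \<Omega> (\<lambda>x. u x *\<^sub>R grad h x)" "set_integrable lborel \<Omega> (\<lambda>x. h x *\<^sub>R g x)"
proof -
  obtain K where K: "compact K" "K \<subseteq> \<Omega>" "\<And>x. x \<notin> K \<Longrightarrow> h x = 0" "\<And>x. x \<notin> K \<Longrightarrow> grad h x = 0"
    using test_function_support[OF assms(2)] by blast
  note h1 = test_function_Ck_on_1[OF assms(2)]
  note c = Ck_on_1_grad(2,3)[OF h1]
  have m: "grad h \<in> borel_measurable lborel" "h \<in> borel_measurable lborel"
    using c[THEN borel_measurable_continuous_onI] by simp_all
  obtain C D where bound: "\<And>x. norm (h x) \<le> C" "\<And>x. norm (grad h x) \<le> D"
    using compact_support_bounded[OF c(2) K(1,3)] compact_support_bounded[OF c(1) K(1,4)] by metis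
  have int: "integrable lborel (\<lambda>x. indicator K x *\<^sub>R u x)" "integrable lborel (\<lambda>x. indicator K x *\<^sub>R g x)"
    using assms(1) K(1,2) by (simp_all only: is_weak_gradient_def locally_integrable_def set_integrable_def)
  have "(indicator K x *\<^sub>R u x) *\<^sub>R grad h x = indicator \<Omega> x *\<^sub>R (u x *\<^sub>R grad h x)"
    "h x *\<^sub>R (indicator K x *\<^sub>R g x) = indicator \<Omega> x *\<^sub>R (h x *\<^sub>R g x)" for x
    using K by (cases "x \<in> K"; auto)+
  then show "set_integrable lborel \<Omega> (\<lambda>x. u x *\<^sub>R grad h x)" "set_integrable lborel \<Omega> (\<lambda>x. h x *\<^sub>R g x)"
    using integrable_scaleR_bounded[OF int(1) m(1) bound(2)]
      integrable_bounded_scaleR[OF int(2) m(2) bound(1)[unfolded real_norm_def]]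
    by (simp_all only: set_integrable_def)
qed

lemma set_integral_lincomb:
  fixes f g :: "'a \<Rightarrow> 'b::{banach, second_countable_topology}"
  assumes "set_integrable M A f" "set_integrable M A g"
  shows "(LINT x:A|M. a *\<^sub>R f x + b *\<^sub>R g x) = a *\<^sub>R (LINT x:A|M. f x) + b *\<^sub>R (LINT x:A|M. g x)"
  using set_integral_add(2)[OF set_integrable_scaleR_right[of a, OF assms(1)] set_integrable_scaleR_right[of b, OF assms(2)]]
  by simp

lemma is_weak_gradient_lincomb:
  assumes u: "is_weak_gradient \<Omega> u g" and v: "is_weak_gradient \<Omega> v k"
  shows "is_weak_gradient \<Omega> (\<lambda>x. a * u x + b * v x) (\<lambda>x. a *\<^sub>R g x + b *\<^sub>R k x)"
  unfolding is_weak_gradient_def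
proof (intro conjI ballI)
  show "locally_integrable \<Omega> (\<lambda>x. a * u x + b * v x)" "locally_integrable \<Omega> (\<lambda>x. a *\<^sub>R g x + b *\<^sub>R k x)"
    using u v locally_integrable_lincomb[of \<Omega> u v a b] locally_integrable_lincomb[of \<Omega> g k a b]
    by (auto simp: is_weak_gradient_def)
  fix h assume h: "h \<in> test_functions \<Omega>"
  note iu = is_weak_gradient_integrable[OF u h] and iv = is_weak_gradient_integrable[OF v h]
  have "(LINT x:\<Omega>|lborel. (a * u x + b * v x) *\<^sub>R grad h x)
      = (LINT x:\<Omega>|lborel. a *\<^sub>R (u x *\<^sub>R grad h x) + b *\<^sub>R (v x *\<^sub>R grad h x))"
    by (simp add: scaleR_left_distrib)
  also have "\<dots> = a *\<^sub>R (LINT x:\<Omega>|lborel. u x *\<^sub>R grad h x) + b *\<^sub>R (LINT x:\<Omega>|lborel. v x *\<^sub>R grad h x)"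
    by (rule set_integral_lincomb[OF iu(1) iv(1)])
  also have "\<dots> = - (a *\<^sub>R (LINT x:\<Omega>|lborel. h x *\<^sub>R g x) + b *\<^sub>R (LINT x:\<Omega>|lborel. h x *\<^sub>R k x))"
    using u v h by (simp add: is_weak_gradient_def)
  also have "a *\<^sub>R (LINT x:\<Omega>|lborel. h x *\<^sub>R g x) + b *\<^sub>R (LINT x:\<Omega>|lborel. h x *\<^sub>R k x)
      = (LINT x:\<Omega>|lborel. a *\<^sub>R (h x *\<^sub>R g x) + b *\<^sub>R (h x *\<^sub>R k x))"
    by (rule set_integral_lincomb[OF iu(2) iv(2), symmetric])
  also have "\<dots> = (LINT x:\<Omega>|lborel. h x *\<^sub>R (a *\<^sub>R g x + b *\<^sub>R k x))"
    by (simp add: scaleR_right_distrib mult.commute)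
  finally show "(LINT x:\<Omega>|lborel. (a * u x + b * v x) *\<^sub>R grad h x)
      = - (LINT x:\<Omega>|lborel. h x *\<^sub>R (a *\<^sub>R g x + b *\<^sub>R k x))" .
qed

text \<open>Two weak gradients of the same function have equal integrals against all test functions.\<close>

lemma weak_grad_AE:
  assumes \<Omega>: "open \<Omega>" and u: "is_weak_gradient \<Omega> u g"
  shows "AE x in lborel. x \<in> \<Omega> \<longrightarrow> weak_grad \<Omega> u x = g x"
proof -
  have w: "is_weak_gradient \<Omega> u (weak_grad \<Omega> u)"
    unfolding weak_grad_def by (rule someI[where P = "is_weak_gradient \<Omega> u"]) (rule u)
  have "AE x in lborel. x \<in> \<Omega> \<longrightarrow> weak_grad \<Omega> u x - g x = 0"
  proof (rule fundamental_lemma[OF \<Omega>])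
    show "locally_integrable \<Omega> (\<lambda>x. weak_grad \<Omega> u x - g x)"
      using u w locally_integrable_lincomb[of \<Omega> "weak_grad \<Omega> u" g 1 "-1"] by (simp add: is_weak_gradient_def)
    fix h assume h: "h \<in> test_functions \<Omega>"
    have "(LINT x:\<Omega>|lborel. h x *\<^sub>R (weak_grad \<Omega> u x - g x))
        = (LINT x:\<Omega>|lborel. h x *\<^sub>R weak_grad \<Omega> u x) - (LINT x:\<Omega>|lborel. h x *\<^sub>R g x)"
      unfolding scaleR_right_diff_distrib
      by (intro set_integral_diff is_weak_gradient_integrable[OF u h] is_weak_gradient_integrable[OF w h])
    moreover have "- (LINT x:\<Omega>|lborel. h x *\<^sub>R weak_grad \<Omega> u x) = - (LINT x:\<Omega>|lborel. h x *\<^sub>R g x)"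
      using u w h unfolding is_weak_gradient_def by (metis (no_types))
    ultimately show "(LINT x:\<Omega>|lborel. h x *\<^sub>R (weak_grad \<Omega> u x - g x)) = 0"
      by (simp only: neg_equal_iff_equal diff_self)
  qed
  then show ?thesis by simp
qed

lemma is_weak_gradient_weak_grad:
  "weakly_differentiable \<Omega> u \<Longrightarrow> is_weak_gradient \<Omega> u (weak_grad \<Omega> u)"
  unfolding weak_grad_def weakly_differentiable_def by (rule someI_ex[where P = "is_weak_gradient \<Omega> u"])

text \<open>The function \<open>weak_grad\<close> is a choice of representative, so it is linear only up to null sets and only on
  weakly differentiable functions.\<close>

lemma weak_grad_lincomb:
  assumes "weakly_differentiable \<Omega> u" "weakly_differentiable \<Omega> v"
  shows "weakly_differentiable \<Omega> (\<lambda>x. a * u x + b * v x)"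
    and "open \<Omega> \<Longrightarrow> AE x in lborel. x \<in> \<Omega> \<longrightarrow>
      weak_grad \<Omega> (\<lambda>x. a * u x + b * v x) x = a *\<^sub>R weak_grad \<Omega> u x + b *\<^sub>R weak_grad \<Omega> v x"
proof -
  note w = is_weak_gradient_lincomb[OF assms[THEN is_weak_gradient_weak_grad], of a b]
  then show "weakly_differentiable \<Omega> (\<lambda>x. a * u x + b * v x)"
    unfolding weakly_differentiable_def by blast
  show "AE x in lborel. x \<in> \<Omega> \<longrightarrow>
      weak_grad \<Omega> (\<lambda>x. a * u x + b * v x) x = a *\<^sub>R weak_grad \<Omega> u x + b *\<^sub>R weak_grad \<Omega> v x" if "open \<Omega>"
    by (rule weak_grad_AE[OF that w])
qed

lemma test_function_weak_gradient:
  assumes "h \<in> test_functions \<Omega>"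
  shows "is_weak_gradient \<Omega> h (grad h)"
  unfolding is_weak_gradient_def locally_integrable_def
proof (intro conjI allI impI ballI)
  have h: "Ck_on 1 h UNIV" using assms by (rule test_function_Ck_on_1)
  fix K assume "compact K \<and> K \<subseteq> \<Omega>"
  then show "set_integrable lborel K h" "set_integrable lborel K (grad h)"
    unfolding set_integrable_def
    by (intro borel_integrable_compact; use Ck_on_1_grad(2,3)[OF h] in \<open>blast intro: continuous_on_subset\<close>)+
next
  fix k assume "k \<in> test_functions \<Omega>"
  then have "Ck_on 1 k UNIV" by (rule test_function_Ck_on_1)
  then show "(LINT x:\<Omega>|lborel. h x *\<^sub>R grad k x) = - (LINT x:\<Omega>|lborel. k x *\<^sub>R grad h x)"
    by (rule integral_by_parts[OF assms])
qed


section \<open>Modular convergence and convergence in \<open>L\<^sup>1\<close>\<close>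

text \<open>Bernoulli's inequality \<open>1 + s \<le> exp s\<close> with \<open>s = (q - 1) ln a\<close>.  The threshold \<open>exp 1\<close> does not depend
  on the exponent, so it serves for unbounded exponents as well.\<close>

lemma powr_div_ge_self:
  fixes a q :: real
  assumes "exp 1 \<le> a" "1 < q"
  shows "a \<le> a powr q / q"
proof -
  have a: "0 < a" using assms(1) exp_gt_zero[of 1] by linarith
  then have "1 \<le> ln a" using assms(1) by (simp add: ln_ge_iff)
  then have "(q - 1) * 1 \<le> (q - 1) * ln a" using assms(2) by (intro mult_left_mono) auto
  then have "q \<le> 1 + (q - 1) * ln a" by (simp only: mult_1_right diff_le_eq add.commute)
  also have "\<dots> \<le> a powr (q - 1)" using a by (simp add: powr_def)
  finally have "a * q \<le> a * a powr (q - 1)" using a by simp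
  also have "\<dots> = a powr q" using a powr_mult_base[of a "q - 1"] by simp
  finally show ?thesis using assms(2) by (simp add: field_simps)
qed

text \<open>Where the exponent is at most \<open>M\<close>, values above \<open>\<epsilon>\<close> are controlled by the modular density with a constant
  depending on \<open>\<epsilon>\<close> and \<open>M\<close>.  Where it is larger, that density can be arbitrarily small for values
  below \<open>1\<close>; there a fixed error \<open>exp 1\<close> is accepted, which is harmless after integration since
  the set \<open>{p > M}\<close> has small measure for large \<open>M\<close>.\<close>

lemma abs_le_modular_density:
  fixes a q \<epsilon> M :: real
  assumes q: "1 < q" and \<epsilon>: "0 < \<epsilon>" "\<epsilon> \<le> 1" and M: "1 \<le> M"
  shows "\<bar>a\<bar> \<le> \<epsilon> + exp 1 * of_bool (M < q) + M / \<epsilon> powr M * (\<bar>a\<bar> powr q / q)"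
proof -
  have eM: "\<epsilon> powr M \<le> 1" "0 < \<epsilon> powr M" using \<epsilon> M by (auto intro: powr_le1)
  then have C: "1 \<le> M / \<epsilon> powr M" using M by (simp add: field_simps)
  have nn: "0 \<le> \<bar>a\<bar> powr q / q" using q by simp
  have T: "0 \<le> M / \<epsilon> powr M * (\<bar>a\<bar> powr q / q)"
    using C nn by (intro mult_nonneg_nonneg) auto
  have E: "0 \<le> exp 1 * (of_bool (M < q) :: real)" by simp
  consider "\<bar>a\<bar> \<le> \<epsilon>" | "\<epsilon> < \<bar>a\<bar>" "q \<le> M" | "\<bar>a\<bar> \<le> exp 1" "M < q" | "exp 1 \<le> \<bar>a\<bar>" "M < q" by linarith
  then show ?thesis
  proof cases
    case 1
    with T E show ?thesis by linarith
  next
    case 2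
    have "\<epsilon> powr M \<le> \<epsilon> powr (q - 1)" using \<epsilon> 2 by (intro powr_mono') auto
    also have "\<dots> \<le> \<bar>a\<bar> powr (q - 1)" using \<epsilon> 2 q by (intro powr_mono2) auto
    finally have "\<epsilon> powr M * q \<le> \<bar>a\<bar> powr (q - 1) * M"
      using 2 q eM by (intro mult_mono) auto
    then have "\<bar>a\<bar> * (\<epsilon> powr M * q) \<le> \<bar>a\<bar> * (\<bar>a\<bar> powr (q - 1) * M)" by (intro mult_left_mono) auto
    also have "\<dots> = M * \<bar>a\<bar> powr q" using \<epsilon> 2 powr_mult_base[of "\<bar>a\<bar>" "q - 1"] by simp
    finally have "\<bar>a\<bar> \<le> M / \<epsilon> powr M * (\<bar>a\<bar> powr q / q)" using eM q by (simp add: field_simps)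
    with E \<epsilon> show ?thesis by linarith
  next
    case 3
    then have "exp 1 * of_bool (M < q) = (exp 1 :: real)" by simp
    with 3 T \<epsilon> show ?thesis by linarith
  next
    case 4
    have "\<bar>a\<bar> \<le> 1 * (\<bar>a\<bar> powr q / q)" using powr_div_ge_self[OF 4(1) q] by simp
    also have "\<dots> \<le> M / \<epsilon> powr M * (\<bar>a\<bar> powr q / q)" using C nn by (intro mult_right_mono)
    finally show ?thesis using E \<epsilon> by linarith
  qed
qed

lemma rho_cong_AE:
  assumes "AE x in lborel. x \<in> \<Omega> \<longrightarrow> \<bar>f x\<bar> = \<bar>g x\<bar>"
  shows "rho \<Omega> p f = rho \<Omega> p g"
  unfolding rho_def by (rule nn_integral_cong_AE) (use assms in \<open>eventually_elim, auto split: split_indicator\<close>)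

lemma set_borel_measurable_norm:
  assumes "set_borel_measurable M A f"
  shows "set_borel_measurable M A (\<lambda>x. norm (f x))"
proof -
  have "(\<lambda>x. norm (indicator A x *\<^sub>R f x)) \<in> borel_measurable M"
    using assms unfolding set_borel_measurable_def by measurable
  then show ?thesis by (simp add: set_borel_measurable_def)
qed

locale variable_exponent_domain =
  fixes \<Omega> :: "(real^'n) set" and p :: "real^'n \<Rightarrow> real"
  assumes open_domain: "open \<Omega>" and bounded_domain: "bounded \<Omega>"
    and continuous_exponent: "continuous_on \<Omega> p" and exponent_gt_1: "\<And>x. x \<in> \<Omega> \<Longrightarrow> 1 < p x"
begin

lemma domain_sets [measurable]: "\<Omega> \<in> sets borel"
  using open_domain by simp

lemma domain_finite: "emeasure lborel \<Omega> < \<infinity>"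
  by (rule emeasure_bounded_finite[OF bounded_domain])

lemma rho_integrand_measurable [measurable]:
  assumes "set_borel_measurable borel \<Omega> u"
  shows "(\<lambda>x. ennreal (\<bar>u x\<bar> powr p x / p x) * indicator \<Omega> x) \<in> borel_measurable borel"
proof -
  have [measurable]: "(\<lambda>x. indicator \<Omega> x *\<^sub>R u x) \<in> borel_measurable borel"
    using assms by (simp add: set_borel_measurable_def)
  have [measurable]: "(\<lambda>x. indicator \<Omega> x *\<^sub>R p x) \<in> borel_measurable borel"
    by (rule borel_measurable_continuous_on_indicator[OF domain_sets continuous_exponent])
  have "(\<lambda>x. ennreal (\<bar>indicator \<Omega> x *\<^sub>R u x\<bar> powr (indicator \<Omega> x *\<^sub>R p x) / (indicator \<Omega> x *\<^sub>R p x)) * indicator \<Omega> x)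
      \<in> borel_measurable borel" by measurable
  also have "(\<lambda>x. ennreal (\<bar>indicator \<Omega> x *\<^sub>R u x\<bar> powr (indicator \<Omega> x *\<^sub>R p x) / (indicator \<Omega> x *\<^sub>R p x)) * indicator \<Omega> x)
      = (\<lambda>x. ennreal (\<bar>u x\<bar> powr p x / p x) * indicator \<Omega> x)"
    by (auto simp: fun_eq_iff split: split_indicator)
  finally show ?thesis .
qed

lemma large_exponent_sets: "{x\<in>\<Omega>. M < p x} \<in> sets borel"
proof -
  have "{x\<in>\<Omega>. M < p x} = \<Omega> \<inter> p -` {M<..}" by auto
  then show ?thesis
    using continuous_open_preimage[OF continuous_exponent open_domain, of "{M<..}"] by simp
qed

lemma L1_le_rho:
  assumes u: "set_borel_measurable borel \<Omega> u" and \<epsilon>: "0 < \<epsilon>" "\<epsilon> \<le> 1" and M: "1 \<le> M"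
  shows "(\<integral>\<^sup>+x\<in>\<Omega>. ennreal \<bar>u x\<bar> \<partial>lborel)
    \<le> ennreal \<epsilon> * emeasure lborel \<Omega> + ennreal (exp 1) * emeasure lborel {x\<in>\<Omega>. M < p x}
      + ennreal (M / \<epsilon> powr M) * rho \<Omega> p u"
proof -
  let ?B = "{x\<in>\<Omega>. M < p x}"
  have [measurable]: "?B \<in> sets borel" by (rule large_exponent_sets)
  note [measurable] = rho_integrand_measurable[OF u]
  have "(\<integral>\<^sup>+x\<in>\<Omega>. ennreal \<bar>u x\<bar> \<partial>lborel)
      \<le> (\<integral>\<^sup>+x. (ennreal \<epsilon> * indicator \<Omega> x + ennreal (exp 1) * indicator ?B x)
          + ennreal (M / \<epsilon> powr M) * (ennreal (\<bar>u x\<bar> powr p x / p x) * indicator \<Omega> x) \<partial>lborel)"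
  proof (rule nn_integral_mono)
    fix x
    show "ennreal \<bar>u x\<bar> * indicator \<Omega> x \<le> (ennreal \<epsilon> * indicator \<Omega> x + ennreal (exp 1) * indicator ?B x)
          + ennreal (M / \<epsilon> powr M) * (ennreal (\<bar>u x\<bar> powr p x / p x) * indicator \<Omega> x)"
    proof (cases "x \<in> \<Omega>")
      case True
      have "ennreal \<bar>u x\<bar> \<le> ennreal (\<epsilon> + exp 1 * of_bool (M < p x) + M / \<epsilon> powr M * (\<bar>u x\<bar> powr p x / p x))"
        by (intro ennreal_leI abs_le_modular_density exponent_gt_1 True \<epsilon> M)
      also have "\<dots> = ennreal \<epsilon> + ennreal (exp 1) * ennreal (of_bool (M < p x))
          + ennreal (M / \<epsilon> powr M) * ennreal (\<bar>u x\<bar> powr p x / p x)"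
      proof -
        have split: "ennreal (a + b * c + d * e) = ennreal a + ennreal b * ennreal c + ennreal d * ennreal e"
          if "0 \<le> a" "0 \<le> b" "0 \<le> c" "0 \<le> d" "0 \<le> e" for a b c d e :: real
          using that by (simp add: ennreal_mult)
        show ?thesis by (rule split) (use \<epsilon> M exponent_gt_1[OF True] in auto)
      qed
      finally show ?thesis using True by (auto simp: indicator_def)
    qed simp
  qed
  also have "\<dots> = ennreal \<epsilon> * emeasure lborel \<Omega> + ennreal (exp 1) * emeasure lborel ?B
      + ennreal (M / \<epsilon> powr M) * rho \<Omega> p u"
    unfolding rho_def by (simp add: nn_integral_add nn_integral_cmult)
  finally show ?thesis .
qed

text \<open>The choice \<open>\<epsilon> = M = 1\<close> in \<open>L1_le_rho\<close> suffices since \<open>\<Omega>\<close> has finite measure.\<close>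

lemma set_integrable_of_rho_finite:
  fixes f :: "real^'n \<Rightarrow> 'b::{banach, second_countable_topology}"
  assumes f: "set_borel_measurable borel \<Omega> f" and fin: "rho \<Omega> p (\<lambda>x. norm (f x)) < \<infinity>"
  shows "set_integrable lborel \<Omega> f"
proof -
  have [measurable]: "(\<lambda>x. indicator \<Omega> x *\<^sub>R f x) \<in> borel_measurable borel"
    using f by (simp add: set_borel_measurable_def)
  from L1_le_rho[OF set_borel_measurable_norm[OF f], of 1 1] have "(\<integral>\<^sup>+x\<in>\<Omega>. ennreal \<bar>norm (f x)\<bar> \<partial>lborel)
      \<le> emeasure lborel \<Omega> + ennreal (exp 1) * emeasure lborel {x\<in>\<Omega>. 1 < p x} + rho \<Omega> p (\<lambda>x. norm (f x))"
    by simp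
  also have "{x\<in>\<Omega>. 1 < p x} = \<Omega>" using exponent_gt_1 by auto
  also have "emeasure lborel \<Omega> + ennreal (exp 1) * emeasure lborel \<Omega> + rho \<Omega> p (\<lambda>x. norm (f x)) < \<infinity>"
    using fin domain_finite by (simp add: ennreal_mult_less_top)
  also have "(\<integral>\<^sup>+x\<in>\<Omega>. ennreal \<bar>norm (f x)\<bar> \<partial>lborel) = (\<integral>\<^sup>+x. ennreal (norm (indicator \<Omega> x *\<^sub>R f x)) \<partial>lborel)"
    by (rule nn_integral_cong) (simp split: split_indicator)
  finally show ?thesis
    unfolding set_integrable_def by (intro integrableI_bounded) auto
qed

lemma large_exponent_measure_tendsto_0:
  "(\<lambda>n. emeasure lborel {x\<in>\<Omega>. real n < p x}) \<longlonglongrightarrow> 0"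
proof -
  have "(\<lambda>n. emeasure lborel {x\<in>\<Omega>. real n < p x}) \<longlonglongrightarrow> emeasure lborel (\<Inter>n. {x\<in>\<Omega>. real n < p x})"
  proof (intro Lim_emeasure_decseq)
    show "range (\<lambda>n. {x\<in>\<Omega>. real n < p x}) \<subseteq> sets lborel"
      using large_exponent_sets by auto
    show "decseq (\<lambda>n. {x\<in>\<Omega>. real n < p x})"
      by (auto simp: decseq_def)
    show "emeasure lborel {x\<in>\<Omega>. real n < p x} \<noteq> \<infinity>" for n
      using emeasure_bounded_finite[OF bounded_subset[OF bounded_domain], of "{x\<in>\<Omega>. real n < p x}"] by auto
  qed
  also have "(\<Inter>n. {x\<in>\<Omega>. real n < p x}) = {}"
  proof -
    have "\<exists>n. \<not> real n < p x" for x
      using reals_Archimedean2[of "p x"] by (metis less_asym)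
    then show ?thesis by blast
  qed
  finally show ?thesis by simp
qed

text \<open>In \<open>L1_le_rho\<close> the parameter \<open>\<epsilon>\<close> is chosen first, then \<open>M\<close>, and the modular term becomes small last.\<close>

lemma L1_tendsto_0_of_rho_tendsto_0:
  assumes u: "\<And>j::nat. set_borel_measurable borel \<Omega> (u j)" and lim: "(\<lambda>j. rho \<Omega> p (u j)) \<longlonglongrightarrow> 0"
  shows "(\<lambda>j. \<integral>\<^sup>+x\<in>\<Omega>. ennreal \<bar>u j x\<bar> \<partial>lborel) \<longlonglongrightarrow> 0"
proof (rule tendsto_zero_ennreal)
  fix r :: real assume r: "0 < r"
  have small: "\<forall>\<^sub>F j in F. c * f j < ennreal (r / 3)" if "(f \<longlongrightarrow> 0) F" "c < \<infinity>" for c :: ennreal and f :: "nat \<Rightarrow> ennreal" and F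
  proof -
    have "((\<lambda>j. c * f j) \<longlongrightarrow> c * 0) F"
      using that by (intro ennreal_tendsto_cmult) auto
    then show ?thesis using r by (auto intro: order_tendstoD(2))
  qed
  have "(\<lambda>n. ennreal (1 / real (Suc n))) \<longlonglongrightarrow> ennreal 0"
    using LIMSEQ_Suc[OF lim_1_over_n] by (rule tendsto_ennrealI)
  then have "\<forall>\<^sub>F n in sequentially. emeasure lborel \<Omega> * ennreal (1 / real (Suc n)) < ennreal (r / 3)"
    using domain_finite by (intro small) auto
  then obtain n where n: "ennreal (1 / real (Suc n)) * emeasure lborel \<Omega> < ennreal (r / 3)"
    by (auto simp: eventually_sequentially mult.commute)
  have "\<forall>\<^sub>F m in sequentially. ennreal (exp 1) * emeasure lborel {x\<in>\<Omega>. real m < p x} < ennreal (r / 3)"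
    by (intro small large_exponent_measure_tendsto_0) auto
  then obtain m where m: "1 \<le> m" "ennreal (exp 1) * emeasure lborel {x\<in>\<Omega>. real m < p x} < ennreal (r / 3)"
    unfolding eventually_sequentially by (metis nle_le)
  let ?C = "ennreal (real m / (1 / real (Suc n)) powr real m)"
  have "\<forall>\<^sub>F j in sequentially. ?C * rho \<Omega> p (u j) < ennreal (r / 3)"
    by (intro small lim) auto
  then show "\<forall>\<^sub>F j in sequentially. (\<integral>\<^sup>+x\<in>\<Omega>. ennreal \<bar>u j x\<bar> \<partial>lborel) < ennreal r"
  proof eventually_elim
    case (elim j)
    have "(\<integral>\<^sup>+x\<in>\<Omega>. ennreal \<bar>u j x\<bar> \<partial>lborel) \<le> ennreal (1 / real (Suc n)) * emeasure lborel \<Omega>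
        + ennreal (exp 1) * emeasure lborel {x\<in>\<Omega>. real m < p x} + ?C * rho \<Omega> p (u j)"
      by (rule L1_le_rho[OF u]) (use m(1) in auto)
    also have "\<dots> < ennreal (r / 3) + ennreal (r / 3) + ennreal (r / 3)"
      by (intro add_strict_mono n m elim)
    also have "\<dots> = ennreal r"
      using r by (simp flip: ennreal_plus)
    finally show ?case .
  qed
qed

end


section \<open>The boundary condition\<close>

lemma rho1_uminus:
  assumes "open \<Omega>" "weakly_differentiable \<Omega> u"
  shows "rho1 \<Omega> p (\<lambda>x. - u x) = rho1 \<Omega> p u"
proof -
  have "AE x in lborel. x \<in> \<Omega> \<longrightarrow> weak_grad \<Omega> (\<lambda>x. - u x) x = - weak_grad \<Omega> u x"
    using weak_grad_lincomb(2)[OF assms(2,2,1), of "-1" 0] by simp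
  then have "grad_energy \<Omega> p (\<lambda>x. - u x) = grad_energy \<Omega> p u"
    by (rule rho_cong_AE[OF eventually_mono]) simp
  then show ?thesis by (simp add: rho1_def rho_def)
qed

lemma V01p_subset: "modular_closed \<Omega> p A \<Longrightarrow> test_functions \<Omega> \<subseteq> A \<Longrightarrow> V01p \<Omega> p \<subseteq> A"
  unfolding V01p_def by blast

text \<open>For \<open>u\<close> smooth up to a regular boundary the divergence theorem identifies this with the integral of
  \<open>k u\<close> times the outer unit normal over the boundary of \<open>\<Omega>\<close>.  Its vanishing for all test functions \<open>k\<close>
  on the whole space expresses zero boundary values without reference to traces.\<close>

definition boundary_functional ::
  "(real^'n) set \<Rightarrow> ((real^'n) \<Rightarrow> real) \<Rightarrow> ((real^'n) \<Rightarrow> real) \<Rightarrow> real^'n" where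
  "boundary_functional \<Omega> k u =
     (LINT x:\<Omega>|lborel. u x *\<^sub>R grad k x) + (LINT x:\<Omega>|lborel. k x *\<^sub>R weak_grad \<Omega> u x)"

lemma test_function_bounded:
  assumes "k \<in> test_functions \<Omega>"
  shows "\<exists>C>0. (\<forall>x. \<bar>k x\<bar> \<le> C) \<and> (\<forall>x. norm (grad k x) \<le> C)"
proof -
  obtain K where K: "compact K" "\<And>x. x \<notin> K \<Longrightarrow> k x = 0" "\<And>x. x \<notin> K \<Longrightarrow> grad k x = 0"
    using test_function_support[OF assms] by blast
  note c = Ck_on_1_grad(2,3)[OF test_function_Ck_on_1[OF assms]]
  obtain C where C: "0 < C" "\<And>x. norm (k x) \<le> C"
    using compact_support_bounded[OF c(2) K(1,2)] by blast
  obtain D where D: "0 < D" "\<And>x. norm (grad k x) \<le> D"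
    using compact_support_bounded[OF c(1) K(1,3)] by blast
  show ?thesis
  proof (intro exI conjI allI)
    show "0 < max C D" using C by simp
    show "\<bar>k x\<bar> \<le> max C D" "norm (grad k x) \<le> max C D" for x
      using C(2)[of x] D(2)[of x] by auto
  qed
qed

lemma test_function_measurable:
  assumes "k \<in> test_functions \<Omega>"
  shows "k \<in> borel_measurable borel" "grad k \<in> borel_measurable borel"
  using Ck_on_1_grad(2,3)[OF test_function_Ck_on_1[OF assms]] by (auto intro: borel_measurable_continuous_onI)

lemma set_integral_scaleR_cong_AE:
  fixes f g :: "real^'n \<Rightarrow> 'b::{banach, second_countable_topology}" and k :: "real^'n \<Rightarrow> real"
  assumes k: "k \<in> borel_measurable borel"
    and fg: "set_borel_measurable borel \<Omega> f" "set_borel_measurable borel \<Omega> g"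
    and ae: "AE x in lborel. x \<in> \<Omega> \<longrightarrow> f x = g x"
  shows "(LINT x:\<Omega>|lborel. k x *\<^sub>R f x) = (LINT x:\<Omega>|lborel. k x *\<^sub>R g x)"
  unfolding set_lebesgue_integral_def
proof (rule integral_cong_AE)
  have m: "k \<in> borel_measurable lborel" "(\<lambda>x. indicator \<Omega> x *\<^sub>R f x) \<in> borel_measurable lborel"
    "(\<lambda>x. indicator \<Omega> x *\<^sub>R g x) \<in> borel_measurable lborel"
    using k fg by (simp_all add: set_borel_measurable_def)
  have "(\<lambda>x. k x *\<^sub>R (indicator \<Omega> x *\<^sub>R f x)) \<in> borel_measurable lborel"
    "(\<lambda>x. k x *\<^sub>R (indicator \<Omega> x *\<^sub>R g x)) \<in> borel_measurable lborel"
    by (rule borel_measurable_scaleR[OF m(1) m(2)], rule borel_measurable_scaleR[OF m(1) m(3)])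
  then show "(\<lambda>x. indicator \<Omega> x *\<^sub>R (k x *\<^sub>R f x)) \<in> borel_measurable lborel"
    "(\<lambda>x. indicator \<Omega> x *\<^sub>R (k x *\<^sub>R g x)) \<in> borel_measurable lborel"
    by (simp_all only: scaleR_left_commute)
  show "AE x in lborel. indicator \<Omega> x *\<^sub>R (k x *\<^sub>R f x) = indicator \<Omega> x *\<^sub>R (k x *\<^sub>R g x)"
    using ae by eventually_elim (simp add: indicator_def)
qed

lemma is_weak_gradient_measurable:
  assumes "open \<Omega>" "is_weak_gradient \<Omega> u g"
  shows "set_borel_measurable borel \<Omega> g"
  by (rule locally_integrable_measurable[OF assms(1)]) (use assms(2) in \<open>simp add: is_weak_gradient_def\<close>)

lemma boundary_functional_test_function:
  assumes \<Omega>: "open \<Omega>" and h: "h \<in> test_functions \<Omega>" and k: "k \<in> test_functions UNIV"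
  shows "boundary_functional \<Omega> k h = 0"
proof -
  have k1: "Ck_on 1 k UNIV" using k by (rule test_function_Ck_on_1)
  have gh: "is_weak_gradient \<Omega> h (grad h)"
    by (rule test_function_weak_gradient[OF h])
  then have "weakly_differentiable \<Omega> h" by (auto simp: weakly_differentiable_def)
  then have "is_weak_gradient \<Omega> h (weak_grad \<Omega> h)"
    by (rule is_weak_gradient_weak_grad)
  then have "(LINT x:\<Omega>|lborel. k x *\<^sub>R weak_grad \<Omega> h x) = (LINT x:\<Omega>|lborel. k x *\<^sub>R grad h x)"
    using is_weak_gradient_measurable[OF \<Omega>] gh weak_grad_AE[OF \<Omega> gh]
    by (intro set_integral_scaleR_cong_AE borel_measurable_continuous_onI Ck_on_1_grad(3)[OF k1])
  then show ?thesis
    using integral_by_parts[OF h k1] by (simp add: boundary_functional_def)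
qed

text \<open>If \<open>f\<close> is not integrable, the left-hand side is \<open>0\<close> by convention.\<close>

lemma norm_integral_le_nn_integral: "ennreal (norm (integral\<^sup>L M f)) \<le> (\<integral>\<^sup>+x. ennreal (norm (f x)) \<partial>M)"
  using integral_norm_bound_ennreal by (cases "integrable M f") (auto simp: not_integrable_integral_eq)

lemma boundary_functional_bound:
  assumes C: "0 < C" "\<And>x. \<bar>k x\<bar> \<le> C" "\<And>x. norm (grad k x) \<le> C"
    and int: "set_integrable lborel \<Omega> w" "set_integrable lborel \<Omega> (weak_grad \<Omega> w)"
  shows "ennreal (norm (boundary_functional \<Omega> k w))
    \<le> ennreal C * ((\<integral>\<^sup>+x\<in>\<Omega>. ennreal \<bar>w x\<bar> \<partial>lborel) + (\<integral>\<^sup>+x\<in>\<Omega>. ennreal \<bar>norm (weak_grad \<Omega> w x)\<bar> \<partial>lborel))"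
proof -
  have m: "(\<lambda>x. ennreal \<bar>w x\<bar> * indicator \<Omega> x) \<in> borel_measurable lborel"
    "(\<lambda>x. ennreal \<bar>norm (weak_grad \<Omega> w x)\<bar> * indicator \<Omega> x) \<in> borel_measurable lborel"
  proof -
    have "(\<lambda>x. ennreal (norm (indicator \<Omega> x *\<^sub>R w x))) \<in> borel_measurable lborel"
      "(\<lambda>x. ennreal (norm (indicator \<Omega> x *\<^sub>R weak_grad \<Omega> w x))) \<in> borel_measurable lborel"
      using int[unfolded set_integrable_def, THEN borel_measurable_integrable] by measurable
    moreover have "ennreal (norm (indicator \<Omega> x *\<^sub>R w x)) = ennreal \<bar>w x\<bar> * indicator \<Omega> x"
      "ennreal (norm (indicator \<Omega> x *\<^sub>R weak_grad \<Omega> w x)) = ennreal \<bar>norm (weak_grad \<Omega> w x)\<bar> * indicator \<Omega> x" for x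
      by (simp_all add: indicator_def)
    ultimately show "(\<lambda>x. ennreal \<bar>w x\<bar> * indicator \<Omega> x) \<in> borel_measurable lborel"
    "(\<lambda>x. ennreal \<bar>norm (weak_grad \<Omega> w x)\<bar> * indicator \<Omega> x) \<in> borel_measurable lborel" by (simp_all only:)
  qed
  have "ennreal (norm (LINT x:\<Omega>|lborel. w x *\<^sub>R grad k x)) \<le> (\<integral>\<^sup>+x. ennreal C * (ennreal \<bar>w x\<bar> * indicator \<Omega> x) \<partial>lborel)"
    unfolding set_lebesgue_integral_def
  proof (rule order_trans[OF norm_integral_le_nn_integral nn_integral_mono])
    fix x
    have "\<bar>w x\<bar> * norm (grad k x) \<le> \<bar>w x\<bar> * C" by (intro mult_left_mono C) simp
    then show "ennreal (norm (indicator \<Omega> x *\<^sub>R (w x *\<^sub>R grad k x))) \<le> ennreal C * (ennreal \<bar>w x\<bar> * indicator \<Omega> x)"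
      using C(1) by (auto simp: indicator_def mult.commute simp flip: ennreal_mult intro!: ennreal_leI)
  qed
  moreover have "ennreal (norm (LINT x:\<Omega>|lborel. k x *\<^sub>R weak_grad \<Omega> w x))
      \<le> (\<integral>\<^sup>+x. ennreal C * (ennreal \<bar>norm (weak_grad \<Omega> w x)\<bar> * indicator \<Omega> x) \<partial>lborel)"
    unfolding set_lebesgue_integral_def
  proof (rule order_trans[OF norm_integral_le_nn_integral nn_integral_mono])
    fix x
    have "\<bar>k x\<bar> * norm (weak_grad \<Omega> w x) \<le> C * norm (weak_grad \<Omega> w x)" by (intro mult_right_mono C) simp
    then show "ennreal (norm (indicator \<Omega> x *\<^sub>R (k x *\<^sub>R weak_grad \<Omega> w x)))
        \<le> ennreal C * (ennreal \<bar>norm (weak_grad \<Omega> w x)\<bar> * indicator \<Omega> x)"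
      using C(1) by (auto simp: indicator_def simp flip: ennreal_mult intro!: ennreal_leI)
  qed
  moreover have "ennreal (norm (boundary_functional \<Omega> k w))
      \<le> ennreal (norm (LINT x:\<Omega>|lborel. w x *\<^sub>R grad k x)) + ennreal (norm (LINT x:\<Omega>|lborel. k x *\<^sub>R weak_grad \<Omega> w x))"
    unfolding boundary_functional_def by (simp add: norm_triangle_ineq flip: ennreal_plus)
  ultimately show ?thesis
    using m by (simp add: nn_integral_cmult distrib_left) (meson add_mono order_trans)
qed

lemma Ck_on_uminus:
  fixes h :: "'a::real_normed_vector \<Rightarrow> real"
  shows "Ck_on k h UNIV \<Longrightarrow> Ck_on k (\<lambda>x. - h x) UNIV"
proof (induction k arbitrary: h)
  case 0
  then show ?case by (auto intro: continuous_on_minus)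
next
  case (Suc k)
  have D: "((\<lambda>x. - h x) has_derivative (\<lambda>v. - frechet_derivative h (at x) v)) (at x)" for x
    using Suc.prems by (intro has_derivative_minus) (simp add: frechet_derivative_works)
  have "frechet_derivative (\<lambda>x. - h x) (at x) = (\<lambda>v. - frechet_derivative h (at x) v)" for x
    using frechet_derivative_at[OF D] by simp
  then show ?case
    using D Suc by (auto simp: differentiable_def)
qed

context variable_exponent_domain
begin

text \<open>Membership in \<open>W1p\<close> controls the modular of a multiple \<open>c u\<close> only; integrability is derived for
  that multiple and then divided by \<open>c\<close>.\<close>

lemma W1pD:
  assumes "u \<in> W1p \<Omega> p"
  shows "set_borel_measurable borel \<Omega> u" "weakly_differentiable \<Omega> u"
    "set_borel_measurable borel \<Omega> (weak_grad \<Omega> u)"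
    "set_integrable lborel \<Omega> u" "set_integrable lborel \<Omega> (weak_grad \<Omega> u)"
proof -
  show u: "set_borel_measurable borel \<Omega> u" "weakly_differentiable \<Omega> u"
    using assms by (auto simp: W1p_def)
  show g: "set_borel_measurable borel \<Omega> (weak_grad \<Omega> u)"
    by (rule is_weak_gradient_measurable[OF open_domain is_weak_gradient_weak_grad[OF u(2)]])
  obtain c where c: "0 < c" "rho1 \<Omega> p (\<lambda>x. c * u x) < \<infinity>"
    using assms by (auto simp: W1p_def)
  then have fin: "rho \<Omega> p (\<lambda>x. norm (c *\<^sub>R u x)) < \<infinity>" "grad_energy \<Omega> p (\<lambda>x. c * u x) < \<infinity>"
    by (simp_all add: rho1_def rho_def)
  have scale: "set_borel_measurable borel \<Omega> (\<lambda>x. c *\<^sub>R f x)" if "set_borel_measurable borel \<Omega> f"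
    for f :: "real^'n \<Rightarrow> 'b::{real_normed_vector, second_countable_topology}"
    using borel_measurable_scaleR[OF borel_measurable_const[of c] that[unfolded set_borel_measurable_def]]
    by (simp only: set_borel_measurable_def scaleR_left_commute)
  have unscale: "set_integrable lborel \<Omega> f" if "set_integrable lborel \<Omega> (\<lambda>x. c *\<^sub>R f x)"
    for f :: "real^'n \<Rightarrow> 'b::{banach, second_countable_topology}"
    using set_integrable_scaleR_right[of "1 / c", OF that] c(1) by simp
  show "set_integrable lborel \<Omega> u"
    by (rule unscale[OF set_integrable_of_rho_finite[OF scale[OF u(1)] fin(1)]])
  have "AE x in lborel. x \<in> \<Omega> \<longrightarrow> weak_grad \<Omega> (\<lambda>x. c * u x) x = c *\<^sub>R weak_grad \<Omega> u x"
    using weak_grad_lincomb(2)[OF u(2,2) open_domain, of c 0] by simp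
  then have "rho \<Omega> p (\<lambda>x. norm (c *\<^sub>R weak_grad \<Omega> u x)) = grad_energy \<Omega> p (\<lambda>x. c * u x)"
    by (auto intro: rho_cong_AE elim!: eventually_mono)
  then show "set_integrable lborel \<Omega> (weak_grad \<Omega> u)"
    using unscale[OF set_integrable_of_rho_finite[OF scale[OF g]]] fin(2) by simp
qed

lemma W1p_uminus:
  assumes "u \<in> W1p \<Omega> p"
  shows "(\<lambda>x. - u x) \<in> W1p \<Omega> p"
proof -
  note u = W1pD[OF assms]
  have w: "weakly_differentiable \<Omega> (\<lambda>x. a * u x)" for a
    using weak_grad_lincomb(1)[OF u(2,2), of a 0] by simp
  obtain c where c: "0 < c" "rho1 \<Omega> p (\<lambda>x. c * u x) < \<infinity>"
    using assms by (auto simp: W1p_def)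
  then have "rho1 \<Omega> p (\<lambda>x. c * - u x) < \<infinity>"
    using rho1_uminus[OF open_domain w, of p c] by simp
  moreover have "set_borel_measurable borel \<Omega> (\<lambda>x. - u x)"
    using borel_measurable_uminus[OF u(1)[unfolded set_borel_measurable_def]] by (simp add: set_borel_measurable_def)
  ultimately show ?thesis
    using c(1) w[of "-1"] by (auto simp: W1p_def)
qed

text \<open>The exponent may be unbounded on \<open>\<Omega>\<close>, but it is bounded on compact subsets.\<close>

lemma rho_finite_compact_support:
  assumes K: "compact K" "K \<subseteq> \<Omega>" "\<And>x. x \<notin> K \<Longrightarrow> f x = 0" and B: "\<And>x. \<bar>f x\<bar> \<le> B"
  shows "rho \<Omega> p f < \<infinity>"
proof -
  have "bounded (p ` K)"
    using compact_continuous_image[OF continuous_on_subset[OF continuous_exponent K(2)] K(1)] compact_imp_bounded by blast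
  then obtain M where M: "\<And>x. x \<in> K \<Longrightarrow> \<bar>p x\<bar> \<le> M"
    by (auto simp: bounded_iff)
  define C where "C = (max 1 B) powr M"
  have "rho \<Omega> p f \<le> (\<integral>\<^sup>+x. ennreal C * indicator K x \<partial>lborel)"
    unfolding rho_def
  proof (rule nn_integral_mono)
    fix x
    show "ennreal (\<bar>f x\<bar> powr p x / p x) * indicator \<Omega> x \<le> ennreal C * indicator K x"
    proof (cases "x \<in> K")
      case True
      then have p: "1 < p x" "p x \<le> M" using K(2) exponent_gt_1 M[OF True] by auto
      have "\<bar>f x\<bar> powr p x / p x \<le> \<bar>f x\<bar> powr p x" using p by (simp add: field_simps mult_le_cancel_right1)
      also have "\<dots> \<le> (max 1 B) powr p x" using B[of x] p by (intro powr_mono2) auto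
      also have "\<dots> \<le> C" unfolding C_def using p by (intro powr_mono) auto
      finally show ?thesis using True by (simp add: indicator_def ennreal_leI)
    qed (use K(3) in simp)
  qed
  also have "\<dots> < \<infinity>"
    using emeasure_bounded_finite[OF compact_imp_bounded[OF K(1)]] K(1)
    by (simp add: nn_integral_cmult ennreal_mult_less_top compact_imp_closed)
  finally show ?thesis .
qed

lemma test_functions_subset_W1p: "test_functions \<Omega> \<subseteq> W1p \<Omega> p"
proof
  fix h assume h: "h \<in> test_functions \<Omega>"
  obtain K where K: "compact K" "K \<subseteq> \<Omega>" "\<And>x. x \<notin> K \<Longrightarrow> h x = 0" "\<And>x. x \<notin> K \<Longrightarrow> grad h x = 0"
    using test_function_support[OF h] by blast
  obtain C where C: "0 < C" "\<And>x. \<bar>h x\<bar> \<le> C" "\<And>x. norm (grad h x) \<le> C"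
    using test_function_bounded[OF h] by blast
  note [measurable] = test_function_measurable[OF h]
  have "grad_energy \<Omega> p h = rho \<Omega> p (\<lambda>x. norm (grad h x))"
    using weak_grad_AE[OF open_domain test_function_weak_gradient[OF h]]
    by (auto intro: rho_cong_AE elim!: eventually_mono)
  also have "\<dots> < \<infinity>"
    by (rule rho_finite_compact_support[OF K(1,2), of _ C]) (use K(4) C in auto)
  finally have "rho1 \<Omega> p (\<lambda>x. 1 * h x) < \<infinity>"
    using rho_finite_compact_support[OF K(1-3) C(2)] by (simp add: rho1_def)
  moreover have "set_borel_measurable borel \<Omega> h"
    unfolding set_borel_measurable_def by measurable
  ultimately show "h \<in> W1p \<Omega> p"
    using test_function_weak_gradient[OF h] zero_less_one unfolding W1p_def weakly_differentiable_def by blast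
qed

lemma weak_grad_diff:
  assumes "u \<in> W1p \<Omega> p" "v \<in> W1p \<Omega> p"
  shows "weakly_differentiable \<Omega> (\<lambda>x. u x - v x)"
    and "AE x in lborel. x \<in> \<Omega> \<longrightarrow> weak_grad \<Omega> (\<lambda>x. u x - v x) x = weak_grad \<Omega> u x - weak_grad \<Omega> v x"
  using weak_grad_lincomb(1)[OF W1pD(2)[OF assms(1)] W1pD(2)[OF assms(2)], of 1 "-1"]
    weak_grad_lincomb(2)[OF W1pD(2)[OF assms(1)] W1pD(2)[OF assms(2)] open_domain, of 1 "-1"] by simp_all

text \<open>If \<open>A\<close> is closed and contains the test functions, then so is and does the set of all \<open>w\<close> with \<open>- w\<close> in
  \<open>A\<close>, and \<open>u\<close> lies in the latter.\<close>

lemma V01p_uminus: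
  assumes "u \<in> V01p \<Omega> p"
  shows "(\<lambda>x. - u x) \<in> V01p \<Omega> p"
  unfolding V01p_def
proof (rule InterI, clarify)
  fix A assume A: "modular_closed \<Omega> p A" "test_functions \<Omega> \<subseteq> A"
  let ?B = "{w \<in> W1p \<Omega> p. (\<lambda>x. - w x) \<in> A}"
  have "modular_closed \<Omega> p ?B"
    unfolding modular_closed_def
  proof (intro conjI allI impI)
    fix f :: "nat \<Rightarrow> _" and w assume *: "range f \<subseteq> ?B \<and> w \<in> W1p \<Omega> p \<and> (\<lambda>j. rho1 \<Omega> p (\<lambda>x. f j x - w x)) \<longlonglongrightarrow> 0"
    then have "rho1 \<Omega> p (\<lambda>x. - f j x - - w x) = rho1 \<Omega> p (\<lambda>x. f j x - w x)" for j
      using rho1_uminus[OF open_domain weak_grad_diff(1), of "f j" w p] by (auto simp: image_subset_iff)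
    then have "(\<lambda>j. rho1 \<Omega> p (\<lambda>x. - f j x - - w x)) \<longlonglongrightarrow> 0" using * by simp
    moreover have "range (\<lambda>j x. - f j x) \<subseteq> A" "(\<lambda>x. - w x) \<in> W1p \<Omega> p"
      using * W1p_uminus by auto
    ultimately have "(\<lambda>x. - w x) \<in> A"
      using A(1) unfolding modular_closed_def by blast
    then show "w \<in> ?B" using * by simp
  qed auto
  moreover have "test_functions \<Omega> \<subseteq> ?B"
  proof
    fix h assume h: "h \<in> test_functions \<Omega>"
    have "(\<lambda>x. - h x) \<in> test_functions \<Omega>"
      using h Ck_on_uminus unfolding test_functions_def by auto
    then show "h \<in> ?B" using A(2) test_functions_subset_W1p h by auto
  qed
  ultimately show "(\<lambda>x. - u x) \<in> A"
    using V01p_subset[of \<Omega> p ?B] assms by blast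
qed

lemma weak_grad_diff_integrable:
  assumes "u \<in> W1p \<Omega> p" "v \<in> W1p \<Omega> p"
  shows "set_borel_measurable borel \<Omega> (weak_grad \<Omega> (\<lambda>x. u x - v x))"
    and "set_integrable lborel \<Omega> (weak_grad \<Omega> (\<lambda>x. u x - v x))"
proof -
  show m: "set_borel_measurable borel \<Omega> (weak_grad \<Omega> (\<lambda>x. u x - v x))"
    using is_weak_gradient_measurable[OF open_domain is_weak_gradient_weak_grad[OF weak_grad_diff(1)[OF assms]]] .
  have "set_integrable lborel \<Omega> (\<lambda>x. weak_grad \<Omega> u x - weak_grad \<Omega> v x)"
    by (intro set_integral_diff W1pD(5) assms)
  moreover from this have "set_borel_measurable lborel \<Omega> (\<lambda>x. weak_grad \<Omega> u x - weak_grad \<Omega> v x)"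
    unfolding set_integrable_def set_borel_measurable_def by (rule borel_measurable_integrable)
  ultimately show "set_integrable lborel \<Omega> (weak_grad \<Omega> (\<lambda>x. u x - v x))"
    using m weak_grad_diff(2)[OF assms] unfolding set_integrable_def set_borel_measurable_def
    by (elim Bochner_Integration.integrable_cong_AE[THEN iffD1, rotated -1]) (auto elim!: eventually_mono simp: indicator_def)
qed

lemma boundary_functional_diff:
  assumes u: "u \<in> W1p \<Omega> p" and v: "v \<in> W1p \<Omega> p" and k: "k \<in> test_functions UNIV"
  shows "boundary_functional \<Omega> k (\<lambda>x. u x - v x) = boundary_functional \<Omega> k u - boundary_functional \<Omega> k v"
proof -
  obtain C where C: "\<And>x. \<bar>k x\<bar> \<le> C" "\<And>x. norm (grad k x) \<le> C"
    using test_function_bounded[OF k] by blast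
  have m: "k \<in> borel_measurable lborel" "grad k \<in> borel_measurable lborel"
    using test_function_measurable[OF k] by simp_all
  have int: "set_integrable lborel \<Omega> (\<lambda>x. w x *\<^sub>R grad k x)" "set_integrable lborel \<Omega> (\<lambda>x. k x *\<^sub>R weak_grad \<Omega> w x)"
    if w: "w \<in> W1p \<Omega> p" for w
    using integrable_scaleR_bounded[OF W1pD(4)[OF w, unfolded set_integrable_def] m(2) C(2)]
      integrable_bounded_scaleR[OF W1pD(5)[OF w, unfolded set_integrable_def] m(1) C(1)]
    by (simp_all only: set_integrable_def scaleR_scaleR real_scaleR_def mult.commute)
  have meas: "set_borel_measurable borel \<Omega> (\<lambda>x. weak_grad \<Omega> u x - weak_grad \<Omega> v x)"
    using borel_measurable_diff[OF W1pD(3)[OF u, unfolded set_borel_measurable_def] W1pD(3)[OF v, unfolded set_borel_measurable_def]]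
    by (simp add: set_borel_measurable_def scaleR_right_diff_distrib)
  have "(LINT x:\<Omega>|lborel. k x *\<^sub>R weak_grad \<Omega> (\<lambda>x. u x - v x) x)
      = (LINT x:\<Omega>|lborel. k x *\<^sub>R (weak_grad \<Omega> u x - weak_grad \<Omega> v x))"
    by (rule set_integral_scaleR_cong_AE[OF test_function_measurable(1)[OF k] weak_grad_diff_integrable(1)[OF u v] meas weak_grad_diff(2)[OF u v]])
  then show ?thesis
    unfolding boundary_functional_def scaleR_left_diff_distrib scaleR_right_diff_distrib
    by (simp add: set_integral_diff[OF int(1)[OF u] int(1)[OF v]] set_integral_diff[OF int(2)[OF u] int(2)[OF v]])
qed

text \<open>The kernel of the functional contains the test functions and is closed because modular convergence
  implies \<open>L\<^sup>1\<close> convergence of functions and gradients.\<close>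

lemma boundary_functional_V01p:
  assumes "u \<in> V01p \<Omega> p" and k: "k \<in> test_functions UNIV"
  shows "boundary_functional \<Omega> k u = 0"
proof -
  let ?A = "{u \<in> W1p \<Omega> p. boundary_functional \<Omega> k u = 0}"
  obtain C where C: "0 < C" "\<And>x. \<bar>k x\<bar> \<le> C" "\<And>x. norm (grad k x) \<le> C"
    using test_function_bounded[OF k] by blast
  have "modular_closed \<Omega> p ?A"
    unfolding modular_closed_def
  proof (intro conjI allI impI)
    fix f :: "nat \<Rightarrow> _" and u assume *: "range f \<subseteq> ?A \<and> u \<in> W1p \<Omega> p \<and> (\<lambda>j. rho1 \<Omega> p (\<lambda>x. f j x - u x)) \<longlonglongrightarrow> 0"
    then have f: "f j \<in> W1p \<Omega> p" "boundary_functional \<Omega> k (f j) = 0" and u: "u \<in> W1p \<Omega> p" for j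
      by (auto simp: image_subset_iff)
    let ?w = "\<lambda>j x. f j x - u x"
    have int: "set_integrable lborel \<Omega> (?w j)" for j
      by (intro set_integral_diff W1pD f u)
    have wd: "weakly_differentiable \<Omega> (?w j)" for j
      by (rule weak_grad_diff(1)[OF f(1) u])
    note int_g = weak_grad_diff_integrable(2)[OF f(1) u]
    have meas: "set_borel_measurable borel \<Omega> (?w j)" "set_borel_measurable borel \<Omega> (\<lambda>x. norm (weak_grad \<Omega> (?w j) x))" for j
      using int[of j] set_borel_measurable_norm[OF weak_grad_diff_integrable(1)[OF f(1) u]]
      by (auto simp: set_borel_measurable_def set_integrable_def dest: borel_measurable_integrable)
    have lim: "(\<lambda>j. rho \<Omega> p (?w j)) \<longlonglongrightarrow> 0" "(\<lambda>j. grad_energy \<Omega> p (?w j)) \<longlonglongrightarrow> 0"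
      by (rule tendsto_sandwich[OF _ _ tendsto_const, of _ _ _ "\<lambda>j. rho1 \<Omega> p (?w j)"]; use * in \<open>simp add: rho1_def\<close>)+
    have "(\<lambda>j. ennreal C * ((\<integral>\<^sup>+x\<in>\<Omega>. ennreal \<bar>?w j x\<bar> \<partial>lborel) + (\<integral>\<^sup>+x\<in>\<Omega>. ennreal \<bar>norm (weak_grad \<Omega> (?w j) x)\<bar> \<partial>lborel)))
       \<longlonglongrightarrow> ennreal C * (0 + 0)"
      by (intro ennreal_tendsto_cmult tendsto_add L1_tendsto_0_of_rho_tendsto_0 meas lim) auto
    moreover have "ennreal (norm (boundary_functional \<Omega> k u))
      \<le> ennreal C * ((\<integral>\<^sup>+x\<in>\<Omega>. ennreal \<bar>?w j x\<bar> \<partial>lborel) + (\<integral>\<^sup>+x\<in>\<Omega>. ennreal \<bar>norm (weak_grad \<Omega> (?w j) x)\<bar> \<partial>lborel))" for j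
      using boundary_functional_bound[OF C int int_g, of j] boundary_functional_diff[OF f(1) u k, of j] f(2)[of j] by simp
    ultimately have "ennreal (norm (boundary_functional \<Omega> k u)) \<le> ennreal C * (0 + 0)"
      by (intro LIMSEQ_le_const) auto
    then show "u \<in> ?A" using u by simp
  qed auto
  moreover have "test_functions \<Omega> \<subseteq> ?A"
    using test_functions_subset_W1p boundary_functional_test_function[OF open_domain _ k] by blast
  ultimately show ?thesis
    using V01p_subset assms(1) by blast
qed

end


section \<open>Functions whose extension by zero has zero gradient\<close>

lemma Ck_on_translate:
  fixes h :: "'a::real_normed_vector \<Rightarrow> 'b::real_normed_vector"
  shows "Ck_on k h UNIV \<Longrightarrow> Ck_on k (\<lambda>x. h (x + a)) UNIV"
proof (induction k arbitrary: h)
  case 0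
  then show ?case
    using continuous_on_compose2[of UNIV h UNIV "\<lambda>x. x + a"] by (simp add: continuous_on_add)
next
  case (Suc k)
  have D: "((\<lambda>x. h (x + a)) has_derivative frechet_derivative h (at (x + a))) (at x)" for x
  proof -
    have "((\<lambda>x. x + a) has_derivative (\<lambda>v. v)) (at x)"
      by (auto intro!: derivative_eq_intros)
    moreover have "(h has_derivative frechet_derivative h (at (x + a))) (at (x + a))"
      using Suc.prems by (simp add: frechet_derivative_works)
    ultimately show ?thesis by (rule has_derivative_compose)
  qed
  have "frechet_derivative (\<lambda>x. h (x + a)) (at x) = frechet_derivative h (at (x + a))" for x
    using frechet_derivative_at[OF D] by simp
  moreover have "Ck_on k (\<lambda>x. frechet_derivative h (at (x + a)) v) UNIV" for v
    using Suc.IH[of "\<lambda>x. frechet_derivative h (at x) v"] Suc.prems by simp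
  ultimately show ?case
    using D by (auto simp: differentiable_def)
qed

lemma test_function_translate:
  assumes h: "h \<in> test_functions UNIV"
  shows "(\<lambda>x. h (x + a)) \<in> test_functions UNIV" and "grad (\<lambda>x. h (x + a)) x = grad h (x + a)"
proof -
  have "bounded {x. h x \<noteq> 0}"
    using h compact_closure unfolding test_functions_def by blast
  then have "bounded ((\<lambda>x. x - a) ` {x. h x \<noteq> 0})"
    by (rule bounded_translation_minus)
  moreover have "{x. h (x + a) \<noteq> 0} \<subseteq> (\<lambda>x. x - a) ` {x. h x \<noteq> 0}"
    by (force intro: image_eqI[where x = "_ + a"])
  ultimately have "compact (closure {x. h (x + a) \<noteq> 0})"
    unfolding compact_closure by (rule bounded_subset)
  then show "(\<lambda>x. h (x + a)) \<in> test_functions UNIV"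
    using h Ck_on_translate[of _ h a] unfolding test_functions_def by auto
  have "((\<lambda>x. x + a) has_derivative (\<lambda>v. v)) (at x)"
    by (auto intro!: derivative_eq_intros)
  from has_derivative_compose[OF this Ck_on_1_grad(1)[OF test_function_Ck_on_1[OF h]]]
  show "grad (\<lambda>x. h (x + a)) x = grad h (x + a)"
    by (rule grad_eqI)
qed

text \<open>The hypothesis makes \<open>t \<mapsto> \<integral>\<^sub>\<Omega> u(x) h(x + t e) dx\<close> constant for every test function \<open>h\<close>, and for large \<open>t\<close>
  the support of the translate misses the bounded set \<open>\<Omega>\<close>.\<close>

lemma zero_of_zero_extension_gradient:
  fixes u :: "real^'n \<Rightarrow> real"
  assumes \<Omega>: "open \<Omega>" "bounded \<Omega>" and u: "set_integrable lborel \<Omega> u"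
    and zero: "\<And>k. k \<in> test_functions UNIV \<Longrightarrow> (LINT x:\<Omega>|lborel. u x *\<^sub>R grad k x) = 0"
  shows "AE x in lborel. x \<in> \<Omega> \<longrightarrow> u x = 0"
proof (rule fundamental_lemma[OF \<Omega>(1)])
  show "locally_integrable \<Omega> u"
    using u by (auto simp: locally_integrable_def compact_imp_closed intro: set_integrable_subset)
  fix h assume h\<Omega>: "h \<in> test_functions \<Omega>"
  then have h: "h \<in> test_functions UNIV" using test_functions_mono[of \<Omega> UNIV] by blast
  obtain K where K: "compact K" "\<And>x. x \<notin> K \<Longrightarrow> h x = 0"
    using test_function_support[OF h] by blast
  define v where "v x = indicator \<Omega> x *\<^sub>R u x" for x
  have v: "integrable lborel v"
    using u by (simp add: v_def[abs_def] set_integrable_def)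
  \<comment> \<open>Any unit vector serves as the direction of translation.\<close>
  define e :: "real^'n" where "e = axis undefined 1"
  have e: "norm e = 1" by (simp add: e_def norm_axis_1)
  define G where "G t = (LINT x|lborel. v x * h (x + t *\<^sub>R e))" for t
  have "(G has_real_derivative 0) (at t)" for t
  proof -
    let ?k = "\<lambda>x. h (x + t *\<^sub>R e)"
    have k: "?k \<in> test_functions UNIV" by (rule test_function_translate(1)[OF h])
    have "integrable lborel (\<lambda>x. v x *\<^sub>R grad ?k x)"
    proof -
      obtain C where C: "\<And>x. norm (grad ?k x) \<le> C" using test_function_bounded[OF k] by blast
      have "grad ?k \<in> borel_measurable lborel" using test_function_measurable(2)[OF k] by simp
      then show ?thesis by (rule integrable_scaleR_bounded[OF v _ C])
    qed
    then have "(LINT x|lborel. v x *\<^sub>R grad ?k x) \<bullet> e = (LINT x|lborel. v x * (grad ?k x \<bullet> e))"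
      by (simp flip: integral_inner_left)
    moreover have "(LINT x|lborel. v x *\<^sub>R grad ?k x) = 0"
      using zero[OF k] by (simp add: v_def set_lebesgue_integral_def)
    ultimately have "(LINT x|lborel. v x * (grad h (x + t *\<^sub>R e) \<bullet> e)) = 0"
      by (simp add: test_function_translate(2)[OF h])
    then show ?thesis
      using derivative_integral_translate[OF v test_function_Ck_on_1[OF h] K, of e t]
      by (simp add: G_def[abs_def])
  qed
  then have const: "G 0 = G t" for t
    using DERIV_isconst_all by blast
  obtain R where R: "K \<union> \<Omega> \<subseteq> ball 0 R"
    using bounded_subset_ballD[of "K \<union> \<Omega>" 0] compact_imp_bounded[OF K(1)] \<Omega>(2) by auto
  have "v x * h (x + (2 * R) *\<^sub>R e) = 0" for x
  proof (cases "x \<in> \<Omega>")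
    case True
    then have "norm x < R" using R by auto
    then have "R < norm (x + (2 * R) *\<^sub>R e)"
      using norm_diff_ineq[of "(2 * R) *\<^sub>R e" x] e by (simp add: add.commute)
    then have "x + (2 * R) *\<^sub>R e \<notin> K" using R by force
    then show ?thesis using K(2) by simp
  qed (simp add: v_def)
  then have "G (2 * R) = 0" unfolding G_def by (simp only: Bochner_Integration.integral_zero)
  then have "G 0 = 0" using const by metis
  then show "(LINT x:\<Omega>|lborel. h x *\<^sub>R u x) = 0"
    by (simp add: G_def v_def set_lebesgue_integral_def mult_ac)
qed

section \<open>Uniqueness\<close>

text \<open>The pairing splits into a radial part
  \<open>(|a|\<^sup>q\<^sup>-\<^sup>1 - |b|\<^sup>q\<^sup>-\<^sup>1) (|a| - |b|)\<close>, which is positive unless the norms agree, and a multiple of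
  \<open>|a| |b| - a \<bullet> b\<close>, which is nonnegative by the Cauchy-Schwarz inequality and, for equal norms, zero
  only if \<open>a = b\<close>.\<close>

lemma power_flux_strictly_monotone:
  fixes a b :: "'a::real_inner"
  assumes q: "1 < q"
  defines "E \<equiv> (norm a powr (q - 2) *\<^sub>R a - norm b powr (q - 2) *\<^sub>R b) \<bullet> (a - b)"
  shows "0 \<le> E" and "E = 0 \<longleftrightarrow> a = b"
proof -
  have mult: "norm x * norm x powr (q - 2) = norm x powr (q - 1)" for x :: 'a
    using powr_mult_base[of "norm x" "q - 2"] by simp
  let ?S = "(norm a powr (q - 1) - norm b powr (q - 1)) * (norm a - norm b)"
  let ?T = "(norm a powr (q - 2) + norm b powr (q - 2)) * (norm a * norm b - a \<bullet> b)"
  have E: "E = ?S + ?T"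
    unfolding E_def mult[symmetric]
    by (simp add: algebra_simps inner_commute power2_norm_eq_inner[symmetric] power2_eq_square)
  have T: "0 \<le> ?T"
    using norm_cauchy_schwarz[of a b] by (intro mult_nonneg_nonneg) auto
  have S_pos: "0 < ?S" if "norm a \<noteq> norm b"
  proof (cases "norm a < norm b")
    case True
    then have "norm a powr (q - 1) < norm b powr (q - 1)" using q by (intro powr_less_mono2) auto
    then show ?thesis using True by (intro mult_neg_neg) auto
  next
    case False
    then have "norm b < norm a" using that by simp
    then have "norm b powr (q - 1) < norm a powr (q - 1)" using q by (intro powr_less_mono2) auto
    then show ?thesis using \<open>norm b < norm a\<close> by (intro mult_pos_pos) auto
  qed
  have S: "0 \<le> ?S" using S_pos by (cases "norm a = norm b") auto
  show "0 \<le> E" using E S T by linarith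
  show "E = 0 \<longleftrightarrow> a = b"
  proof
    assume "E = 0"
    then have "?S = 0" "?T = 0" using E S T by linarith+
    then have ab: "norm a = norm b" using S_pos by fastforce
    show "a = b"
    proof (cases "a = 0")
      case True
      then show ?thesis using ab by simp
    next
      case False
      then have "0 < norm a powr (q - 2) + norm b powr (q - 2)" by (intro add_pos_nonneg) auto
      then have "norm a * norm b = a \<bullet> b" using \<open>?T = 0\<close> by simp
      then have "a \<bullet> b = a \<bullet> a" "b \<bullet> b = a \<bullet> a"
        using ab by (simp_all add: dot_square_norm power2_eq_square)
      then have "(a - b) \<bullet> (a - b) = 0"
        by (simp add: inner_diff_left inner_diff_right inner_commute)
      then show ?thesis by simp
    qed
  qed (simp add: E_def)
qed

lemma (in variable_exponent_domain) V01p_subset_W1p: "V01p \<Omega> p \<subseteq> W1p \<Omega> p"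
  by (rule V01p_subset) (use test_functions_subset_W1p in \<open>auto simp: modular_closed_def\<close>)

text \<open>The function \<open>\<phi> - w\<close> is inserted as competitor: it is in \<open>V\<^sub>0\<close> by symmetry, and its difference to \<open>\<phi>\<close> is
  \<open>- w\<close>, of finite energy.\<close>

lemma (in variable_exponent_domain) flux_pairing_nonpositive:
  assumes vi: "variational_inequality \<Omega> p \<phi> v" and w: "w \<in> W1p \<Omega> p"
    and V: "(\<lambda>x. w x - \<phi> x) \<in> V01p \<Omega> p" and fin: "grad_energy \<Omega> p w < \<infinity>"
  shows "set_integrable lborel \<Omega> (\<lambda>x. p_flux \<Omega> p v x \<bullet> weak_grad \<Omega> (\<lambda>y. v y - w y) x)"
    and "(LINT x:\<Omega>|lborel. p_flux \<Omega> p v x \<bullet> weak_grad \<Omega> (\<lambda>y. v y - w y) x) \<le> 0"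
proof -
  have "(\<lambda>x. \<phi> x - w x) \<in> V01p \<Omega> p" using V01p_uminus[OF V] by simp
  moreover have "grad_energy \<Omega> p (\<lambda>x. - w x) = grad_energy \<Omega> p w"
    using weak_grad_lincomb(2)[OF W1pD(2,2)[OF w] open_domain, of "-1" 0]
    by (intro rho_cong_AE) (auto elim!: eventually_mono)
  moreover have "(\<lambda>x. (\<phi> x - w x) - \<phi> x) = (\<lambda>x. - w x)" by simp
  moreover have "(\<lambda>y. (\<phi> y - w y) + v y - \<phi> y) = (\<lambda>y. v y - w y)" by auto
  ultimately show "set_integrable lborel \<Omega> (\<lambda>x. p_flux \<Omega> p v x \<bullet> weak_grad \<Omega> (\<lambda>y. v y - w y) x)"
    "(LINT x:\<Omega>|lborel. p_flux \<Omega> p v x \<bullet> weak_grad \<Omega> (\<lambda>y. v y - w y) x) \<le> 0"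
    using vi[unfolded variational_inequality_def, rule_format, of "\<lambda>x. \<phi> x - w x"] fin by simp_all
qed

theorem theorem7p5:
  fixes \<Omega> :: "(real^'n) set" and p \<phi> v1 v2 :: "real^'n \<Rightarrow> real"
  assumes "bounded_C2_domain \<Omega>"
    and "continuous_on \<Omega> p" and "\<forall>x\<in>\<Omega>. 1 < p x" and "real CARD('n) < (INF x\<in>\<Omega>. p x)"
    and "\<phi> \<in> W1p \<Omega> p" and "grad_energy \<Omega> p \<phi> < \<infinity>"
    and "dirichlet_solution \<Omega> p \<phi> v1" and "grad_energy \<Omega> p v1 < \<infinity>"
    and "variational_inequality \<Omega> p \<phi> v1"
    and "dirichlet_solution \<Omega> p \<phi> v2" and "grad_energy \<Omega> p v2 < \<infinity>"
    and "variational_inequality \<Omega> p \<phi> v2"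
  shows "AE x in lborel. x \<in> \<Omega> \<longrightarrow> v1 x = v2 x"
proof -
  interpret variable_exponent_domain \<Omega> p
    using assms(1-3) by unfold_locales (auto simp: bounded_C2_domain_def)
  have v: "v1 \<in> W1p \<Omega> p" "v2 \<in> W1p \<Omega> p"
    and V: "(\<lambda>x. v1 x - \<phi> x) \<in> V01p \<Omega> p" "(\<lambda>x. v2 x - \<phi> x) \<in> V01p \<Omega> p"
    using assms(7,10) by (auto simp: dirichlet_solution_def)
  let ?F = "\<lambda>x. p_flux \<Omega> p v1 x \<bullet> weak_grad \<Omega> (\<lambda>y. v1 y - v2 y) x
    + p_flux \<Omega> p v2 x \<bullet> weak_grad \<Omega> (\<lambda>y. v2 y - v1 y) x"
  note I1 = flux_pairing_nonpositive[OF assms(9) v(2) V(2) assms(11)]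
  note I2 = flux_pairing_nonpositive[OF assms(12) v(1) V(1) assms(8)]
  have int: "integrable lborel (\<lambda>x. indicator \<Omega> x *\<^sub>R ?F x)"
    using set_integral_add(1)[OF I1(1) I2(1)] by (simp only: set_integrable_def)
  have le: "(LINT x|lborel. indicator \<Omega> x *\<^sub>R ?F x) \<le> 0"
    using set_integral_add(2)[OF I1(1) I2(1)] I1(2) I2(2) unfolding set_lebesgue_integral_def by linarith
  have F: "AE x in lborel. x \<in> \<Omega> \<longrightarrow> 0 \<le> ?F x \<and> (?F x = 0 \<longleftrightarrow> weak_grad \<Omega> v1 x = weak_grad \<Omega> v2 x)"
    using weak_grad_diff(2)[OF v] weak_grad_diff(2)[OF v(2,1)]
  proof eventually_elim
    case (elim x)
    show ?case
    proof
      assume x: "x \<in> \<Omega>"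
      have "?F x = (p_flux \<Omega> p v1 x - p_flux \<Omega> p v2 x) \<bullet> (weak_grad \<Omega> v1 x - weak_grad \<Omega> v2 x)"
        using elim x by (simp add: inner_diff_left inner_diff_right)
      then show "0 \<le> ?F x \<and> (?F x = 0 \<longleftrightarrow> weak_grad \<Omega> v1 x = weak_grad \<Omega> v2 x)"
        using power_flux_strictly_monotone[OF exponent_gt_1[OF x], of "weak_grad \<Omega> v1 x" "weak_grad \<Omega> v2 x"]
        by (simp only: p_flux_def)
    qed
  qed
  have nonneg: "AE x in lborel. 0 \<le> indicator \<Omega> x *\<^sub>R ?F x"
    using F by eventually_elim (simp add: indicator_def)
  have "(LINT x|lborel. indicator \<Omega> x *\<^sub>R ?F x) = 0"
    using le integral_nonneg_AE[OF nonneg] by linarith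
  then have "AE x in lborel. indicator \<Omega> x *\<^sub>R ?F x = 0"
    using integral_nonneg_eq_0_iff_AE[OF int nonneg] by blast
  then have grads: "AE x in lborel. x \<in> \<Omega> \<longrightarrow> weak_grad \<Omega> (\<lambda>y. v1 y - v2 y) x = 0"
    using F weak_grad_diff(2)[OF v] by eventually_elim (auto simp: indicator_def)
  have "(LINT x:\<Omega>|lborel. (v1 x - v2 x) *\<^sub>R grad k x) = 0" if k: "k \<in> test_functions UNIV" for k
  proof -
    have "boundary_functional \<Omega> k (\<lambda>x. (v1 x - \<phi> x) - (v2 x - \<phi> x)) = 0"
      using boundary_functional_diff[OF V[THEN subsetD[OF V01p_subset_W1p]] k] V[THEN boundary_functional_V01p, OF k]
      by (simp only: diff_self)
    then have "boundary_functional \<Omega> k (\<lambda>x. v1 x - v2 x) = 0" by simp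
    moreover have "(LINT x:\<Omega>|lborel. k x *\<^sub>R weak_grad \<Omega> (\<lambda>y. v1 y - v2 y) x) = (LINT x:\<Omega>|lborel. k x *\<^sub>R 0)"
      by (rule set_integral_scaleR_cong_AE[OF test_function_measurable(1)[OF k] weak_grad_diff_integrable(1)[OF v] _ grads])
        (simp add: set_borel_measurable_def)
    ultimately show ?thesis by (simp add: boundary_functional_def)
  qed
  moreover have "set_integrable lborel \<Omega> (\<lambda>x. v1 x - v2 x)"
    by (intro set_integral_diff W1pD(4) v)
  ultimately have "AE x in lborel. x \<in> \<Omega> \<longrightarrow> v1 x - v2 x = 0"
    using open_domain bounded_domain by (intro zero_of_zero_extension_gradient)
  then show ?thesis by simp
qed

end
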